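(* Let $F$ be a free group (of possibly infinite rank), let $\phi:F\to F$ be an injective endomorphism of $F$, and let $G_\phi=\langle F,t\mid txt^{-1}=\phi(x),\ x\in F\rangle$ be the mapping torus group of $\phi$. Then for every two-generator subgroup $H\le G_\phi$, either $H$ is free or $H$ is conjugate in $G_\phi$ to a finitary sub-mapping torus subgroup of $G_\phi$.
   Context: A two-generator subgroup is a subgroup generated by two (not necessarily distinct or nontrivial) elements. A finitely generated subgroup $H\le G_\phi$ is called a finitary sub-mapping torus (or just sub-mapping torus) of $G_\phi$ if there exist $u\in F$, an integer $m\ge 1$ and a nontrivial finitely generated subgroup $V\le F$ such that, with $s=ut^m$, one has $H=\langle s,V\rangle$ and $sVs^{-1}\le V$. *)

theory Defs
  imports "HOL-Algebra.Generated_Groups"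
begin

text \<open>
  The letter \<open>(x, True)\<close> stands for the generator \<open>x\<close>, the letter \<open>(x, False)\<close> for its formal
  inverse. Relations are pairs \<open>(u, v)\<close> of words, read as \<open>u = v\<close>.
\<close>

type_synonym 'g word = "('g \<times> bool) list"

definition words :: "'g set \<Rightarrow> 'g word set"
  where "words A = lists (A \<times> UNIV)"

inductive_set word_cong :: "'g set \<Rightarrow> ('g word \<times> 'g word) set \<Rightarrow> ('g word \<times> 'g word) set"
  for A :: "'g set" and R :: "('g word \<times> 'g word) set"
where
  refl: "w \<in> words A \<Longrightarrow> (w, w) \<in> word_cong A R"
| sym: "(u, v) \<in> word_cong A R \<Longrightarrow> (v, u) \<in> word_cong A R"
| trans: "(u, v) \<in> word_cong A R \<Longrightarrow> (v, w) \<in> word_cong A R \<Longrightarrow> (u, w) \<in> word_cong A R"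
| append: "(u, u') \<in> word_cong A R \<Longrightarrow> (v, v') \<in> word_cong A R
    \<Longrightarrow> (u @ v, u' @ v') \<in> word_cong A R"
| cancel: "x \<in> A \<Longrightarrow> ([(x, b), (x, \<not> b)], []) \<in> word_cong A R"
| relation: "(u, v) \<in> R \<Longrightarrow> u \<in> words A \<Longrightarrow> v \<in> words A \<Longrightarrow> (u, v) \<in> word_cong A R"

definition presented_group :: "'g set \<Rightarrow> ('g word \<times> 'g word) set \<Rightarrow> 'g word set monoid"
  where "presented_group A R =
    \<lparr> carrier = words A // word_cong A R,
      mult = (\<lambda>X Y. \<Union>u\<in>X. \<Union>v\<in>Y. word_cong A R `` {u @ v}),
      one = word_cong A R `` {[]} \<rparr>"

lemma word_cong_words:
  assumes "(u, v) \<in> word_cong A R"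
  shows "u \<in> words A \<and> v \<in> words A"
  using assms by induction (auto simp: words_def)

lemma equiv_word_cong: "equiv (words A) (word_cong A R)"
proof (rule equivI)
  show "word_cong A R \<subseteq> words A \<times> words A"
    using word_cong_words by fast
  show "refl_on (words A) (word_cong A R)"
    by (auto intro!: refl_onI word_cong.refl)
  show "sym (word_cong A R)"
    by (auto intro: symI word_cong.sym)
  show "trans (word_cong A R)"
    by (rule transI) (rule word_cong.trans)
qed

lemma presented_group_mult_class:
  assumes "u \<in> words A" "v \<in> words A"
  shows "(word_cong A R `` {u}) \<otimes>\<^bsub>presented_group A R\<^esub> (word_cong A R `` {v})
    = word_cong A R `` {u @ v}"
proof -
  have "congruent2 (word_cong A R) (word_cong A R) (\<lambda>u v. word_cong A R `` {u @ v})"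
    by (intro congruent2I' equiv_class_eq[OF equiv_word_cong] word_cong.append)
  from UN_equiv_class2[OF equiv_word_cong equiv_word_cong this assms]
  show ?thesis by (simp add: presented_group_def)
qed

lemma word_cong_inverse:
  assumes "w \<in> words A"
  shows "(rev (map (\<lambda>(x, b). (x, \<not> b)) w) @ w, []) \<in> word_cong A R"
  using assms
proof (induction w)
  case Nil
  show ?case by (auto intro: word_cong.refl simp: words_def)
next
  case (Cons a w)
  obtain x b where a: "a = (x, b)" by (cases a)
  let ?i = "rev (map (\<lambda>(x, b). (x, \<not> b)) w)"
  from Cons.prems a have x: "x \<in> A" and w: "w \<in> words A" by (auto simp: words_def)
  from w have i: "?i \<in> words A" by (auto simp: words_def)
  have "([(x, \<not> b), (x, b)] @ w, [] @ w) \<in> word_cong A R"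
    using word_cong.append[OF word_cong.cancel[OF x, of "\<not> b"] word_cong.refl[OF w]] by simp
  from word_cong.append[OF word_cong.refl[OF i] this]
  have "(?i @ [(x, \<not> b), (x, b)] @ w, ?i @ w) \<in> word_cong A R" by simp
  from word_cong.trans[OF this Cons.IH[OF w]] show ?case by (simp add: a)
qed

lemma group_presented_group: "group (presented_group A R)"
proof -
  let ?G = "presented_group A R" and ?c = "\<lambda>w. word_cong A R `` {w}"
  have carr: "carrier ?G = ?c ` words A"
    by (auto simp: presented_group_def quotient_def)
  have one: "\<one>\<^bsub>?G\<^esub> = ?c []"
    by (simp add: presented_group_def)
  have nil: "[] \<in> words A"
    by (simp add: words_def)
  have app: "u @ v \<in> words A" if "u \<in> words A" "v \<in> words A" for u v
    using that by (simp add: words_def)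
  show ?thesis
  proof (rule groupI)
    fix X assume "X \<in> carrier ?G"
    then obtain w where w: "w \<in> words A" "X = ?c w" by (auto simp: carr)
    let ?i = "rev (map (\<lambda>(x, b). (x, \<not> b)) w)"
    from w have i: "?i \<in> words A" by (auto simp: words_def)
    have "?c ?i \<otimes>\<^bsub>?G\<^esub> X = ?c (?i @ w)"
      using presented_group_mult_class[OF i w(1)] w(2) by simp
    also have "\<dots> = \<one>\<^bsub>?G\<^esub>"
      unfolding one by (rule equiv_class_eq[OF equiv_word_cong word_cong_inverse[OF w(1)]])
    finally show "\<exists>Y\<in>carrier ?G. Y \<otimes>\<^bsub>?G\<^esub> X = \<one>\<^bsub>?G\<^esub>"
      using i by (auto simp: carr)
  qed (auto simp: carr one nil app presented_group_mult_class)
qed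

definition free_group_on :: "'g set \<Rightarrow> 'g word set monoid"
  where "free_group_on B = presented_group B {}"

text \<open>
  A basis of a free group may be taken inside the group itself, so ranging over index sets of the
  element type imposes no bound on the rank.
\<close>

definition is_free_group :: "('a, 'm) monoid_scheme \<Rightarrow> bool"
  where "is_free_group G \<longleftrightarrow> group G \<and> (\<exists>B :: 'a set. free_group_on B \<cong> G)"

datatype 'a torus_gen = Base 'a | Stable

text \<open>
  The relations are the multiplication table of \<open>F\<close> together with \<open>t x t\<inverse> = \<phi> x\<close>.
\<close>

definition torus_gens :: "('a, 'm) monoid_scheme \<Rightarrow> 'a torus_gen set"
  where "torus_gens F = insert Stable (Base ` carrier F)"

definition torus_rels ::
    "('a, 'm) monoid_scheme \<Rightarrow> ('a \<Rightarrow> 'a) \<Rightarrow> ('a torus_gen word \<times> 'a torus_gen word) set"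
  where "torus_rels F \<phi> =
    {([(Base x, True), (Base y, True)], [(Base (x \<otimes>\<^bsub>F\<^esub> y), True)]) | x y.
        x \<in> carrier F \<and> y \<in> carrier F}
    \<union> {([(Stable, True), (Base x, True), (Stable, False)], [(Base (\<phi> x), True)]) | x.
        x \<in> carrier F}"

definition mapping_torus ::
    "('a, 'm) monoid_scheme \<Rightarrow> ('a \<Rightarrow> 'a) \<Rightarrow> 'a torus_gen word set monoid"
  where "mapping_torus F \<phi> = presented_group (torus_gens F) (torus_rels F \<phi>)"

definition torus_base :: "('a, 'm) monoid_scheme \<Rightarrow> ('a \<Rightarrow> 'a) \<Rightarrow> 'a \<Rightarrow> 'a torus_gen word set"
  where "torus_base F \<phi> x = word_cong (torus_gens F) (torus_rels F \<phi>) `` {[(Base x, True)]}"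

definition torus_stable :: "('a, 'm) monoid_scheme \<Rightarrow> ('a \<Rightarrow> 'a) \<Rightarrow> 'a torus_gen word set"
  where "torus_stable F \<phi> = word_cong (torus_gens F) (torus_rels F \<phi>) `` {[(Stable, True)]}"

definition fg_subgroup :: "'a set \<Rightarrow> ('a, 'm) monoid_scheme \<Rightarrow> bool"
  where "fg_subgroup H G \<longleftrightarrow> (\<exists>S. finite S \<and> S \<subseteq> carrier G \<and> H = generate G S)"

definition two_generator_subgroup :: "'a set \<Rightarrow> ('a, 'm) monoid_scheme \<Rightarrow> bool"
  where "two_generator_subgroup H G \<longleftrightarrow>
    (\<exists>a\<in>carrier G. \<exists>b\<in>carrier G. H = generate G {a, b})"

definition conjugate_in :: "('a, 'm) monoid_scheme \<Rightarrow> 'a set \<Rightarrow> 'a set \<Rightarrow> bool"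
  where "conjugate_in G H K \<longleftrightarrow>
    (\<exists>g\<in>carrier G. H = (\<lambda>x. g \<otimes>\<^bsub>G\<^esub> x \<otimes>\<^bsub>G\<^esub> inv\<^bsub>G\<^esub> g) ` K)"

text \<open>
  A subgroup \<open>V\<close> of \<open>F\<close> is regarded as a subgroup of the mapping torus through its image under
  \<^const>\<open>torus_base\<close>.
\<close>

definition sub_mapping_torus ::
    "('a, 'm) monoid_scheme \<Rightarrow> ('a \<Rightarrow> 'a) \<Rightarrow> 'a torus_gen word set set \<Rightarrow> bool"
  where "sub_mapping_torus F \<phi> H \<longleftrightarrow>
    (let G = mapping_torus F \<phi>; \<iota> = torus_base F \<phi>; t = torus_stable F \<phi> in
      fg_subgroup H G \<and>
      (\<exists>u\<in>carrier F. \<exists>m::nat. \<exists>V. m \<ge> 1 \<and> fg_subgroup V F \<and> V \<noteq> {\<one>\<^bsub>F\<^esub>} \<and>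
        (let s = \<iota> u \<otimes>\<^bsub>G\<^esub> (t [^]\<^bsub>G\<^esub> m) in
          H = generate G (insert s (\<iota> ` V)) \<and>
          (\<lambda>x. s \<otimes>\<^bsub>G\<^esub> x \<otimes>\<^bsub>G\<^esub> inv\<^bsub>G\<^esub> s) ` (\<iota> ` V) \<subseteq> \<iota> ` V)))"

end

theory Submission
  imports Defs
begin

text \<open>
  Write \<open>t\<close> for the stable letter and let \<open>H\<close> be generated by \<open>a\<close> and \<open>b\<close>. The exponent of \<open>t\<close> is
  additive, so Euclid's algorithm, carried out on generators, produces generators \<open>s\<close>, \<open>y\<close> of \<open>H\<close> such
  that \<open>y\<close> has exponent \<open>0\<close> and \<open>s\<close> has exponent \<open>m \<ge> 0\<close>. Every element of exponent \<open>m\<close> is carried into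
  \<open>F t\<^sup>m\<close> by conjugation with a large power of \<open>t\<close>; up to conjugation, therefore, \<open>s = u t\<^sup>m\<close> and
  \<open>y = v\<close> with \<open>u\<close>, \<open>v\<close> in \<open>F\<close>. For \<open>m = 0\<close> the group \<open>H\<close> is isomorphic to a subgroup of \<open>F\<close> and
  \<open>nielsen_schreier\<close> applies. For \<open>m \<ge> 1\<close> conjugation by \<open>s\<close> induces the endomorphism
  \<open>\<psi> x = u \<phi>\<^sup>m(x) u\<inverse>\<close> of \<open>F\<close>, and the outcome depends only on the orbit \<open>v\<close>, \<open>\<psi> v\<close>, \<open>\<psi> (\<psi> v)\<close>, ... .

  The heart of the proof is \<open>orbit_free_or_finitely_generated\<close>: for an endomorphism \<open>\<psi>\<close> of a free
  group, the orbit of an element is either freely independent or generates a finitely generated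
  subgroup \<open>W\<close>. If it is freely independent, then \<open>s\<close> and \<open>v\<close> are freely independent, because a word of
  exponent \<open>0\<close> in \<open>s\<close> is a product of conjugates of \<open>v\<close> by powers of \<open>s\<close>
  (\<open>freely_independent_pair\<close>). If \<open>W\<close> is finitely generated, then \<open>H\<close> is generated by \<open>s\<close> and \<open>W\<close> while
  \<open>\<psi>\<close> maps \<open>W\<close> into itself, so \<open>H\<close> is a sub-mapping torus; only for \<open>v = 1\<close> is \<open>W\<close> trivial, and then
  \<open>H\<close> is infinite cyclic.

  For the dichotomy, let \<open>B\<close> be a basis of \<open>W\<close>, which is free by \<open>nielsen_schreier\<close>, and consider the
  images of the orbit in the abelianisation of \<open>W\<close>, a free abelian group on \<open>B\<close> on which \<open>\<psi>\<close> acts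
  linearly. A linear relation among these images is propagated by \<open>\<psi>\<close> along the whole orbit, as a
  linear recurrence; hence all of them are supported on the finitely many coordinates met by an initial
  segment, and since they span, \<open>B\<close> is finite. If the images are linearly independent, then the orbit is
  freely independent (\<open>linearly_independent_imp_word_trivial\<close>). This last step uses the Magnus
  expansion \<open>b \<mapsto> 1 + b\<close> into non-commuting power series: substituting elements with linearly
  independent images into a word transforms the lowest-degree term of its expansion by a tensor power
  of an injective linear map, and so cannot make it vanish.

  That \<open>F\<close> embeds in the mapping torus (\<open>base_inj\<close>), so that freeness can be tested inside \<open>F\<close>, is seen
  by evaluating words at a high power of \<open>t\<close>, where all exponents of \<open>\<phi>\<close> that occur are non-negative
  and \<open>\<phi>\<close> acts injectively.
\<close>

section \<open>Words and their values in a group\<close>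

definition eval_word :: "('b, 'm) monoid_scheme \<Rightarrow> ('g \<Rightarrow> 'b) \<Rightarrow> 'g word \<Rightarrow> 'b"
  where "eval_word G f w =
    foldr (\<lambda>(x, b) g. (if b then f x else inv\<^bsub>G\<^esub> f x) \<otimes>\<^bsub>G\<^esub> g) w \<one>\<^bsub>G\<^esub>"

definition inv_word :: "'g word \<Rightarrow> 'g word"
  where "inv_word w = rev (map (\<lambda>(x, b). (x, \<not> b)) w)"

definition subst_word :: "('g \<Rightarrow> 'h word) \<Rightarrow> 'g word \<Rightarrow> 'h word"
  where "subst_word u w = concat (map (\<lambda>(x, b). if b then u x else inv_word (u x)) w)"

lemma words_simps [simp]:
  "[] \<in> words A"
  "(x, b) # w \<in> words A \<longleftrightarrow> x \<in> A \<and> w \<in> words A"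
  "u @ v \<in> words A \<longleftrightarrow> u \<in> words A \<and> v \<in> words A"
  by (auto simp: words_def)

lemma words_induct [consumes 1, case_names Nil Cons]:
  assumes "w \<in> words A" "P []"
    and "\<And>x b w. x \<in> A \<Longrightarrow> w \<in> words A \<Longrightarrow> P w \<Longrightarrow> P ((x, b) # w)"
  shows "P w"
  using assms by (induction w) auto

lemma words_mono: "w \<in> words A \<Longrightarrow> A \<subseteq> B \<Longrightarrow> w \<in> words B"
  by (induction w) auto

lemma words_letters: "w \<in> words A \<Longrightarrow> fst ` set w \<subseteq> B \<Longrightarrow> w \<in> words B"
  by (induction w) auto

lemma words_replicate [simp]: "x \<in> A \<Longrightarrow> replicate n (x, b) \<in> words A"
  by (auto simp: words_def)

lemma inv_word_simps [simp]:
  "inv_word [] = []"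
  "inv_word ((x, b) # w) = inv_word w @ [(x, \<not> b)]"
  by (auto simp: inv_word_def)

lemma inv_word_in_words [simp]: "w \<in> words A \<Longrightarrow> inv_word w \<in> words A"
  by (induction w) auto

lemma inv_word_inv_word [simp]: "inv_word (inv_word w) = w"
  by (induction w) (auto simp: inv_word_def)

lemma inv_word_append [simp]: "inv_word (u @ v) = inv_word v @ inv_word u"
  by (simp add: inv_word_def)

lemma inv_word_replicate [simp]: "inv_word (replicate n (x, b)) = replicate n (x, \<not> b)"
  by (simp add: inv_word_def)

lemma subst_word_simps [simp]:
  "subst_word u [] = []"
  "subst_word u ((x, b) # w) = (if b then u x else inv_word (u x)) @ subst_word u w"
  "subst_word u (v @ w) = subst_word u v @ subst_word u w"
  by (auto simp: subst_word_def)

lemma subst_word_in_words: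
  "w \<in> words A \<Longrightarrow> (\<And>x. x \<in> A \<Longrightarrow> u x \<in> words B) \<Longrightarrow> subst_word u w \<in> words B"
  by (induction w) auto

subsection \<open>Calculating with congruent words\<close>

lemmas word_cong_trans [trans] = word_cong.trans

lemma word_cong_inv_right: "w \<in> words A \<Longrightarrow> (w @ inv_word w, []) \<in> word_cong A R"
  using word_cong_inverse[of "inv_word w" A R] by (simp flip: inv_word_def)

lemma word_cong_inv_left: "w \<in> words A \<Longrightarrow> (inv_word w @ w, []) \<in> word_cong A R"
  using word_cong_inverse[of w A R] by (simp flip: inv_word_def)

lemma word_cong_Cons:
  "(u, v) \<in> word_cong A R \<Longrightarrow> x \<in> A \<Longrightarrow> ((x, b) # u, (x, b) # v) \<in> word_cong A R"
  using word_cong.append[OF word_cong.refl[of "[(x, b)]" A R], of u v] by simp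

lemma word_cong_cancel_Cons:
  "x \<in> A \<Longrightarrow> w \<in> words A \<Longrightarrow> ((x, b) # (x, \<not> b) # w, w) \<in> word_cong A R"
  using word_cong.append[OF word_cong.cancel[of x A b R] word_cong.refl[of w A R]] by simp

lemma word_cong_mono: "(u, v) \<in> word_cong A {} \<Longrightarrow> A \<subseteq> B \<Longrightarrow> (u, v) \<in> word_cong B R"
  by (induction rule: word_cong.induct) (auto intro: word_cong.intros words_mono)

text \<open>
  The universal property of the free group, on the level of words.
\<close>

lemma word_cong_subst:
  assumes "(v, w) \<in> word_cong A {}" and u: "\<And>x. x \<in> A \<Longrightarrow> u x \<in> words B"
  shows "(subst_word u v, subst_word u w) \<in> word_cong B R"
  using assms(1)
proof induction
  case (cancel x b)
  then show ?case
    using word_cong_inv_right[OF u, of x R] word_cong_inv_left[OF u, of x R] by (cases b) auto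
qed (auto intro: word_cong.intros subst_word_in_words u)

subsection \<open>Evaluation\<close>

context group
begin

lemma eval_word_simps [simp]:
  "eval_word G f [] = \<one>"
  "eval_word G f ((x, b) # w) = (if b then f x else inv (f x)) \<otimes> eval_word G f w"
  by (auto simp: eval_word_def)

lemma eval_word_closed [intro, simp]:
  "w \<in> words A \<Longrightarrow> f \<in> A \<rightarrow> carrier G \<Longrightarrow> eval_word G f w \<in> carrier G"
  by (induction w rule: words_induct) auto

lemma eval_word_append:
  assumes "u \<in> words A" "v \<in> words A" "f \<in> A \<rightarrow> carrier G"
  shows "eval_word G f (u @ v) = eval_word G f u \<otimes> eval_word G f v"
  using assms(1) by (induction u rule: words_induct) (use assms in \<open>auto simp: m_assoc Pi_iff\<close>)

lemma eval_word_inv: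
  assumes "w \<in> words A" "f \<in> A \<rightarrow> carrier G"
  shows "eval_word G f (inv_word w) = inv (eval_word G f w)"
  using assms(1)
proof (induction w rule: words_induct)
  case (Cons x b w)
  then show ?case
    using assms(2) eval_word_append[of "inv_word w" A "[(x, \<not> b)]" f]
    by (auto simp: inv_mult_group Pi_iff)
qed auto

lemma eval_word_subst:
  assumes "w \<in> words A" "\<And>x. x \<in> A \<Longrightarrow> u x \<in> words B" "f \<in> B \<rightarrow> carrier G"
  shows "eval_word G f (subst_word u w) = eval_word G (\<lambda>x. eval_word G f (u x)) w"
  using assms(1)
proof (induction w rule: words_induct)
  case (Cons x b w)
  then show ?case
    using assms by (simp add: eval_word_append[of _ B] eval_word_inv[of _ B] subst_word_in_words[of w A])
qed auto

lemma eval_word_fun_cong: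
  "w \<in> words A \<Longrightarrow> (\<And>x. x \<in> A \<Longrightarrow> f x = g x) \<Longrightarrow> eval_word G f w = eval_word G g w"
  by (induction w rule: words_induct) auto

text \<open>
  Von Dyck's theorem: an assignment that satisfies the relations is constant on congruence classes.
\<close>

lemma eval_word_cong:
  assumes "(u, v) \<in> word_cong A R" "f \<in> A \<rightarrow> carrier G"
    and "\<And>u v. (u, v) \<in> R \<Longrightarrow> u \<in> words A \<Longrightarrow> v \<in> words A \<Longrightarrow> eval_word G f u = eval_word G f v"
  shows "eval_word G f u = eval_word G f v"
  using assms(1)
proof induction
  case (append u u' v v')
  then show ?case
    using word_cong_words[OF append(1)] word_cong_words[OF append(2)] assms(2)
    by (simp add: eval_word_append[of _ A])
next
  case (cancel x b)
  then show ?case using assms(2) by (auto simp: Pi_iff)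
qed (use assms(3) in auto)

lemma eval_word_hom:
  assumes "group K" "h \<in> hom G K" "w \<in> words A" "f \<in> A \<rightarrow> carrier G"
  shows "h (eval_word G f w) = eval_word K (\<lambda>x. h (f x)) w"
proof -
  interpret h: group_hom G K h
    using assms by (simp add: group_hom_def group_hom_axioms_def is_group)
  show ?thesis
    using assms(3) by (induction w rule: words_induct) (use assms(4) in \<open>auto simp: Pi_iff\<close>)
qed

lemma eval_word_subgroup:
  assumes "subgroup W G" "w \<in> words A" "f \<in> A \<rightarrow> W"
  shows "eval_word G f w \<in> W"
  using assms(2)
  by (induction w rule: words_induct)
    (use assms in \<open>auto simp: Pi_iff subgroup.one_closed subgroup.m_closed subgroup.m_inv_closed\<close>)

lemma generate_eq_eval_words:
  assumes "f \<in> A \<rightarrow> carrier G"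
  shows "generate G (f ` A) = eval_word G f ` words A"
proof
  have "\<exists>w\<in>words A. g = eval_word G f w" if "g \<in> generate G (f ` A)" for g
    using that
  proof induction
    case one
    show ?case by (rule bexI[of _ "[]"]) auto
  next
    case (incl h)
    then obtain x where "x \<in> A" "h = f x" by auto
    then show ?case using assms by (intro bexI[of _ "[(x, True)]"]) (auto simp: Pi_iff)
  next
    case (inv h)
    then obtain x where "x \<in> A" "h = f x" by auto
    then show ?case using assms by (intro bexI[of _ "[(x, False)]"]) (auto simp: Pi_iff)
  next
    case (eng g h)
    then obtain u v where "u \<in> words A" "v \<in> words A" "g = eval_word G f u" "h = eval_word G f v"
      by auto
    then show ?case using assms by (intro bexI[of _ "u @ v"]) (auto simp: eval_word_append[of _ A])
  qed
  then show "generate G (f ` A) \<subseteq> eval_word G f ` words A" by auto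
  have "subgroup (generate G (f ` A)) G"
    using assms by (intro generate_is_subgroup) auto
  then show "eval_word G f ` words A \<subseteq> generate G (f ` A)"
    using eval_word_subgroup[of "generate G (f ` A)" _ A f] by (auto intro: generate.incl)
qed

end

section \<open>Free bases inside a group\<close>

text \<open>
  A condition on families rather than sets: it forces \<open>f\<close> to be injective on \<open>A\<close>, and it allows
  the index set to have another type than the group, as needed for orbits indexed by \<^typ>\<open>nat\<close>.
\<close>

definition freely_independent :: "('b, 'm) monoid_scheme \<Rightarrow> ('g \<Rightarrow> 'b) \<Rightarrow> 'g set \<Rightarrow> bool"
  where "freely_independent G f A \<longleftrightarrow> f \<in> A \<rightarrow> carrier G \<and>
    (\<forall>w\<in>words A. eval_word G f w = \<one>\<^bsub>G\<^esub> \<longrightarrow> (w, []) \<in> word_cong A {})"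

abbreviation word_class :: "'g set \<Rightarrow> 'g word \<Rightarrow> 'g word set"
  where "word_class A w \<equiv> word_cong A {} `` {w}"

lemma carrier_free_group_on: "carrier (free_group_on A) = word_class A ` words A"
  by (auto simp: free_group_on_def presented_group_def quotient_def)

lemma word_class_eq_iff:
  "u \<in> words A \<Longrightarrow> v \<in> words A \<Longrightarrow> word_class A u = word_class A v \<longleftrightarrow> (u, v) \<in> word_cong A {}"
  using eq_equiv_class_iff[OF equiv_word_cong] by metis

lemma word_class_mult:
  "u \<in> words A \<Longrightarrow> v \<in> words A \<Longrightarrow>
    word_class A u \<otimes>\<^bsub>free_group_on A\<^esub> word_class A v = word_class A (u @ v)"
  unfolding free_group_on_def by (rule presented_group_mult_class)

lemma one_free_group_on: "\<one>\<^bsub>free_group_on A\<^esub> = word_class A []"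
  by (simp add: free_group_on_def presented_group_def)

lemma group_free_group_on: "group (free_group_on A)"
  unfolding free_group_on_def by (rule group_presented_group)

lemma inv_word_class:
  assumes "w \<in> words A"
  shows "inv\<^bsub>free_group_on A\<^esub> word_class A w = word_class A (inv_word w)"
proof -
  interpret P: group "free_group_on A" by (rule group_free_group_on)
  have "word_class A (inv_word w) \<otimes>\<^bsub>free_group_on A\<^esub> word_class A w = \<one>\<^bsub>free_group_on A\<^esub>"
    using assms word_cong_inv_left[OF assms]
    by (simp add: word_class_mult one_free_group_on word_class_eq_iff)
  then show ?thesis using assms
    by (intro P.inv_equality) (auto simp: carrier_free_group_on)
qed

lemma eval_word_class:
  assumes "w \<in> words A" "\<And>x. x \<in> A \<Longrightarrow> u x \<in> words B"
  shows "eval_word (free_group_on B) (\<lambda>x. word_class B (u x)) w = word_class B (subst_word u w)"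
proof -
  interpret P: group "free_group_on B" by (rule group_free_group_on)
  show ?thesis using assms(1)
    by (induction w rule: words_induct)
      (use assms(2) in \<open>auto simp: one_free_group_on word_class_mult inv_word_class subst_word_in_words[of _ A]\<close>)
qed

context group
begin

lemma freely_independent_image:
  assumes "freely_independent G f A"
  shows "freely_independent G (\<lambda>g. g) (f ` A)"
  unfolding freely_independent_def
proof (intro conjI ballI impI)
  have f: "f \<in> A \<rightarrow> carrier G" using assms by (simp add: freely_independent_def)
  then show "(\<lambda>g. g) \<in> f ` A \<rightarrow> carrier G" by auto
  fix w assume w: "w \<in> words (f ` A)" "eval_word G (\<lambda>g. g) w = \<one>"
  define r where "r = (\<lambda>g. [(inv_into A f g, True)])"
  have r: "r g \<in> words A" if "g \<in> f ` A" for g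
    using that by (auto simp: r_def inv_into_into)
  have "eval_word G f (subst_word r w) = eval_word G (\<lambda>g. eval_word G f (r g)) w"
    using w r f by (intro eval_word_subst) auto
  also have "\<dots> = eval_word G (\<lambda>g. g) w"
    using f by (intro eval_word_fun_cong[OF w(1)]) (auto simp: r_def f_inv_into_f inv_into_into Pi_iff)
  finally have "(subst_word r w, []) \<in> word_cong A {}"
    using w r assms by (auto simp: freely_independent_def intro!: subst_word_in_words)
  from word_cong_subst[OF this, of "\<lambda>x. [(f x, True)]" "f ` A" "{}"]
  have "(subst_word (\<lambda>x. [(f x, True)]) (subst_word r w), []) \<in> word_cong (f ` A) {}" by auto
  moreover have "subst_word (\<lambda>x. [(f x, True)]) (subst_word r w) = w"
    using w(1) by (induction w rule: words_induct) (auto simp: r_def f_inv_into_f)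
  ultimately show "(w, []) \<in> word_cong (f ` A) {}" by simp
qed

text \<open>
  Evaluation of words, read on congruence classes, is the isomorphism. The class of a word determines
  its value, so the representative chosen by \<open>SOME\<close> does not matter.
\<close>

theorem freely_independent_imp_free:
  assumes "freely_independent G f A"
  shows "is_free_group (G\<lparr>carrier := generate G (f ` A)\<rparr>)"
proof -
  define B where "B = f ` A"
  have ind: "freely_independent G (\<lambda>g. g) B"
    using freely_independent_image[OF assms] by (simp add: B_def)
  then have B: "B \<subseteq> carrier G" and B': "(\<lambda>g. g) \<in> B \<rightarrow> carrier G" by (auto simp: freely_independent_def)
  define H where "H = generate G B"
  have sub: "subgroup H G" unfolding H_def by (rule generate_is_subgroup[OF B])
  have H: "H = eval_word G (\<lambda>g. g) ` words B"
    using generate_eq_eval_words[OF B'] by (simp add: H_def)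
  define e where "e = (\<lambda>X. eval_word G (\<lambda>g. g) (SOME w. w \<in> X))"
  have e: "e (word_class B w) = eval_word G (\<lambda>g. g) w" if "w \<in> words B" for w
  proof -
    have "w \<in> word_class B w" using that by (auto intro: word_cong.refl)
    then have "(SOME v. v \<in> word_class B w) \<in> word_class B w" by (rule someI)
    then have "(w, SOME v. v \<in> word_class B w) \<in> word_cong B {}" by auto
    from eval_word_cong[OF this B'] show ?thesis by (simp add: e_def)
  qed
  have "e \<in> iso (free_group_on B) (G\<lparr>carrier := H\<rparr>)"
  proof (rule isoI)
    show "e \<in> hom (free_group_on B) (G\<lparr>carrier := H\<rparr>)"
      using B' by (auto intro!: homI simp: carrier_free_group_on e H word_class_mult eval_word_append[of _ B])
    show "bij_betw e (carrier (free_group_on B)) (carrier (G\<lparr>carrier := H\<rparr>))"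
      unfolding bij_betw_def
    proof
      interpret P: group "free_group_on B" by (rule group_free_group_on)
      show "inj_on e (carrier (free_group_on B))"
      proof (rule inj_onI)
        fix X Y
        assume X: "X \<in> carrier (free_group_on B)" and Y: "Y \<in> carrier (free_group_on B)"
          and eq: "e X = e Y"
        from X Y obtain u v where u: "u \<in> words B" "X = word_class B u"
          and v: "v \<in> words B" "Y = word_class B v"
          by (auto simp: carrier_free_group_on)
        have "eval_word G (\<lambda>g. g) (u @ inv_word v) = \<one>"
          using eq u v B' eval_word_closed[OF v(1) B']
          by (simp add: e eval_word_append[of _ B] eval_word_inv[of _ B])
        then have "(u @ inv_word v, []) \<in> word_cong B {}"
          using ind u v by (simp add: freely_independent_def)
        then have "word_class B u \<otimes>\<^bsub>free_group_on B\<^esub> inv\<^bsub>free_group_on B\<^esub> word_class B v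
            = \<one>\<^bsub>free_group_on B\<^esub>"
          using u v by (simp add: inv_word_class word_class_mult one_free_group_on word_class_eq_iff)
        then show "X = Y" using X Y u v P.inv_equality P.inv_inv P.inv_closed by metis
      qed
      show "e ` carrier (free_group_on B) = carrier (G\<lparr>carrier := H\<rparr>)"
        by (simp add: carrier_free_group_on e H image_image)
    qed
  qed
  then have "free_group_on B \<cong> (G\<lparr>carrier := H\<rparr>)" by (auto simp: is_iso_def)
  moreover have "group (G\<lparr>carrier := H\<rparr>)" by (rule subgroup_imp_group[OF sub])
  ultimately show ?thesis unfolding is_free_group_def H_def B_def by blast
qed

end

lemma is_free_group_obtains_basis:
  fixes F :: "('a, 'm) monoid_scheme"
  assumes "is_free_group F"
  obtains f :: "'a \<Rightarrow> 'a" and A :: "'a set"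
  where "freely_independent F f A" "generate F (f ` A) = carrier F"
proof -
  interpret F: group F using assms by (simp add: is_free_group_def)
  obtain A :: "'a set" and h where h: "h \<in> iso (free_group_on A) F"
    using assms by (auto simp: is_free_group_def is_iso_def)
  interpret P: group "free_group_on A" by (rule group_free_group_on)
  define f where "f = (\<lambda>x. h (word_class A [(x, True)]))"
  have hh: "h \<in> hom (free_group_on A) F" and bij: "bij_betw h (carrier (free_group_on A)) (carrier F)"
    using h by (auto simp: iso_def)
  have c: "(\<lambda>x. word_class A [(x, True)]) \<in> A \<rightarrow> carrier (free_group_on A)"
    by (auto simp: carrier_free_group_on)
  have f: "f \<in> A \<rightarrow> carrier F"
    using c hh by (auto simp: f_def hom_def Pi_iff)
  have "eval_word F f w = h (word_class A w)" if "w \<in> words A" for w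
  proof -
    have "subst_word (\<lambda>x. [(x, True)]) w = w"
      using that by (induction w rule: words_induct) auto
    then have "eval_word (free_group_on A) (\<lambda>x. word_class A [(x, True)]) w = word_class A w"
      using eval_word_class[OF that, of "\<lambda>x. [(x, True)]" A] by simp
    with P.eval_word_hom[OF F.is_group hh that c] show ?thesis by (simp add: f_def)
  qed
  note ev = this
  have "freely_independent F f A"
    unfolding freely_independent_def
  proof (intro conjI ballI impI f)
    fix w assume w: "w \<in> words A" "eval_word F f w = \<one>\<^bsub>F\<^esub>"
    then have "h (word_class A w) = h (word_class A [])" using ev[of "[]"] ev[of w] by simp
    then have "word_class A w = word_class A []"
      using bij w by (auto simp: bij_betw_def carrier_free_group_on dest!: inj_onD)
    then show "(w, []) \<in> word_cong A {}" using w by (simp add: word_class_eq_iff)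
  qed
  moreover have "generate F (f ` A) = carrier F"
    using bij ev by (simp add: F.generate_eq_eval_words[OF f] bij_betw_def carrier_free_group_on image_image)
  ultimately show ?thesis by (rule that)
qed

section \<open>Exponent sums and the Magnus expansion\<close>

definition exp_sum :: "'b \<Rightarrow> 'b word \<Rightarrow> int"
  where "exp_sum x w = (\<Sum>(y, b)\<leftarrow>w. if y = x then if b then 1 else -1 else 0)"

lemma exp_sum_simps [simp]:
  "exp_sum x [] = 0"
  "exp_sum x ((y, b) # w) = (if y = x then if b then 1 else -1 else 0) + exp_sum x w"
  "exp_sum x (u @ v) = exp_sum x u + exp_sum x v"
  by (auto simp: exp_sum_def)

lemma exp_sum_inv_word [simp]: "exp_sum x (inv_word w) = - exp_sum x w"
  by (induction w) auto

lemma exp_sum_eq_0: "x \<notin> fst ` set w \<Longrightarrow> exp_sum x w = 0"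
  by (induction w) auto

lemma exp_sum_subst_word_eq_0: "(\<And>i. exp_sum x (u i) = 0) \<Longrightarrow> exp_sum x (subst_word u p) = 0"
  by (induction p) auto

lemma exp_sum_cong: "(u, v) \<in> word_cong A {} \<Longrightarrow> exp_sum x u = exp_sum x v"
  by (induction rule: word_cong.induct) auto

lemma exp_sum_subst_word:
  assumes "finite A" "w \<in> words A"
  shows "exp_sum x (subst_word u w) = (\<Sum>y\<in>A. exp_sum y w * exp_sum x (u y))"
  using assms(2)
proof (induction w rule: words_induct)
  case (Cons y b w)
  have "(\<Sum>z\<in>A. exp_sum z ((y, b) # w) * exp_sum x (u z)) =
      (\<Sum>z\<in>A. if z = y then (if b then 1 else -1) * exp_sum x (u z) else 0) + exp_sum x (subst_word u w)"
    unfolding Cons.IH sum.distrib[symmetric] by (intro sum.cong) (auto simp: algebra_simps)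
  also have "\<dots> = (if b then 1 else -1) * exp_sum x (u y) + exp_sum x (subst_word u w)"
    using Cons.hyps assms(1) by simp
  finally show ?case by auto
qed auto

text \<open>
  A function \<open>f\<close> on lists is read as the formal power series \<open>\<Sum>xs. f xs * xs\<close> in non-commuting
  variables. Multiplication from the left by \<open>1 + b\<close> and by its inverse \<open>1 - b + b b - ...\<close> are
  described directly as operators, so that composition of functions takes the place of the product
  of series.
\<close>

fun magnus_letter :: "'b \<times> bool \<Rightarrow> ('b list \<Rightarrow> int) \<Rightarrow> 'b list \<Rightarrow> int"
where
  "magnus_letter l f [] = f []"
| "magnus_letter (b, True) f (x # xs) = f (x # xs) + (if x = b then f xs else 0)"
| "magnus_letter (b, False) f (x # xs) =
    f (x # xs) - (if x = b then magnus_letter (b, False) f xs else 0)"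

definition magnus :: "'b word \<Rightarrow> ('b list \<Rightarrow> int) \<Rightarrow> 'b list \<Rightarrow> int"
  where "magnus w f = foldr magnus_letter w f"

definition one_series :: "'b list \<Rightarrow> int"
  where "one_series xs = (if xs = [] then 1 else 0)"

lemma one_series_simps [simp]: "one_series [] = 1" "one_series (x # xs) = 0"
  by (auto simp: one_series_def)

lemma magnus_simps [simp]:
  "magnus [] f = f"
  "magnus (l # w) f = magnus_letter l (magnus w f)"
  "magnus (u @ v) f = magnus u (magnus v f)"
  by (auto simp: magnus_def)

lemma magnus_letter_cancel [simp]: "magnus_letter (b, c) (magnus_letter (b, \<not> c) f) = f"
proof
  fix xs show "magnus_letter (b, c) (magnus_letter (b, \<not> c) f) xs = f xs"
    by (induction xs) (cases c; auto)+
qed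

lemma magnus_cong: "(u, v) \<in> word_cong A {} \<Longrightarrow> magnus u = magnus v"
  by (induction rule: word_cong.induct) (auto simp: fun_eq_iff[of "magnus _"])

lemma magnus_letter_sum:
  "magnus_letter l (\<lambda>xs. \<Sum>i\<in>I. a i * f i xs) xs = (\<Sum>i\<in>I. a i * magnus_letter l (f i) xs)"
  by (induction l "f undefined" xs rule: magnus_letter.induct)
    (auto simp: sum.distrib algebra_simps sum_subtractf)

lemma magnus_sum:
  "magnus w (\<lambda>xs. \<Sum>i\<in>I. a i * f i xs) = (\<lambda>xs. \<Sum>i\<in>I. a i * magnus w (f i) xs)"
proof (induction w)
  case (Cons l w)
  show ?case by (simp add: Cons.IH magnus_letter_sum fun_eq_iff)
qed auto

lemma magnus_letter_local:
  assumes "\<And>ys. length ys \<le> length xs \<Longrightarrow> f ys = g ys"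
  shows "magnus_letter l f xs = magnus_letter l g xs"
  using assms
proof (induction xs)
  case (Cons x xs)
  then show ?case by (cases l rule: prod.exhaust; cases "snd l") auto
qed auto

lemma magnus_local:
  assumes "\<And>ys. length ys \<le> length xs \<Longrightarrow> f ys = g ys"
  shows "magnus w f xs = magnus w g xs"
  using assms by (induction w arbitrary: xs) (auto intro!: magnus_letter_local)

lemma magnus_letter_leading:
  assumes "\<And>ys. length ys < n \<Longrightarrow> f ys = 0"
  shows "length xs \<le> n \<Longrightarrow> magnus_letter l f xs = f xs"
    and "length xs = n \<Longrightarrow> magnus_letter l f (x # xs) = f (x # xs) + exp_sum x [l] * f xs"
proof -
  obtain b c where l: "l = (b, c)" by (cases l)
  show 1: "magnus_letter l f xs = f xs" if "length xs \<le> n" for xs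
    using that
  proof (induction xs)
    case (Cons y ys)
    then show ?case using assms[of ys] l by (cases c) auto
  qed auto
  show "magnus_letter l f (x # xs) = f (x # xs) + exp_sum x [l] * f xs" if "length xs = n"
    using 1[of xs] that l by (cases c) auto
qed

text \<open>
  The expansion of \<open>w\<close> is \<open>1 + \<Sum>x. exp_sum x w * x\<close> up to terms of degree at least two. Multiplying a
  series without terms of degree below \<open>n\<close> therefore preserves its degree \<open>n\<close> part and changes the
  next one in a linear way.
\<close>

lemma magnus_leading:
  assumes "\<And>ys. length ys < n \<Longrightarrow> f ys = 0"
  shows "length xs \<le> n \<Longrightarrow> magnus w f xs = f xs"
    and "length xs = n \<Longrightarrow> magnus w f (x # xs) = f (x # xs) + exp_sum x w * f xs"
proof -
  have *: "(\<forall>xs. length xs \<le> n \<longrightarrow> magnus w f xs = f xs) \<and>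
     (\<forall>x xs. length xs = n \<longrightarrow> magnus w f (x # xs) = f (x # xs) + exp_sum x w * f xs)"
  proof (induction w)
    case (Cons l w)
    then have "\<And>ys. length ys < n \<Longrightarrow> magnus w f ys = 0" using assms by auto
    from magnus_letter_leading[OF this, where l = l] Cons show ?case
      by (cases l) (auto simp: algebra_simps)
  qed auto
  from * show "length xs \<le> n \<Longrightarrow> magnus w f xs = f xs"
    and "length xs = n \<Longrightarrow> magnus w f (x # xs) = f (x # xs) + exp_sum x w * f xs" by auto
qed

subsection \<open>Faithfulness\<close>

definition power_word :: "'b \<Rightarrow> int \<Rightarrow> 'b word"
  where "power_word x e = replicate (nat \<bar>e\<bar>) (x, e > 0)"

definition syllable_word :: "('b \<times> int) list \<Rightarrow> 'b word"
  where "syllable_word ss = concat (map (\<lambda>(x, e). power_word x e) ss)"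

lemma syllable_word_simps [simp]:
  "syllable_word [] = []"
  "syllable_word ((x, e) # ss) = power_word x e @ syllable_word ss"
  by (auto simp: syllable_word_def)

lemma power_word_0 [simp]: "power_word x 0 = []"
  by (simp add: power_word_def)

lemma power_word_in_words [simp]: "x \<in> A \<Longrightarrow> power_word x e \<in> words A"
  by (auto simp: power_word_def words_def)

text \<open>
  The only case with a genuine cancellation is that of a letter meeting a power of the opposite sign.
\<close>

lemma power_word_step:
  assumes "x \<in> A"
  shows "((x, b) # power_word x e, power_word x (e + (if b then 1 else -1))) \<in> word_cong A R"
proof -
  consider "e = 0" | "e \<noteq> 0" "(e > 0) = b" | "e \<noteq> 0" "(e > 0) \<noteq> b" by blast
  then show ?thesis
  proof cases
    case 1
    then show ?thesis using assms
      by (cases b) (auto simp: power_word_def intro!: word_cong.refl)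
  next
    case 2
    then have "(x, b) # power_word x e = power_word x (e + (if b then 1 else -1))"
      by (cases b) (auto simp: power_word_def nat_add_distrib abs_if nat_diff_distrib
          simp flip: replicate_Suc intro!: arg_cong[of _ _ "\<lambda>n. replicate n _"])
    then show ?thesis using assms by (auto intro!: word_cong.refl simp flip: words_simps(2))
  next
    case 3
    define e' where "e' = e + (if b then 1 else -1)"
    obtain n where n: "nat \<bar>e\<bar> = Suc n" using 3(1) by (cases "nat \<bar>e\<bar>") auto
    then have "nat \<bar>e'\<bar> = n" "n \<noteq> 0 \<Longrightarrow> (e' > 0) = (e > 0)" using 3 by (auto simp: e'_def)
    then have "power_word x e = (x, \<not> b) # power_word x e'"
      using n 3 by (cases "n = 0") (auto simp: power_word_def)
    then show ?thesis using assms by (auto simp flip: e'_def intro!: word_cong_cancel_Cons)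
  qed
qed

text \<open>
  Free reduction, with runs of a single letter collected into powers.
\<close>

lemma syllable_form_exists:
  assumes "w \<in> words A"
  shows "\<exists>ss. distinct_adj (map fst ss) \<and> 0 \<notin> snd ` set ss \<and>
    (w, syllable_word ss) \<in> word_cong A R"
  using assms
proof (induction w rule: words_induct)
  case Nil
  show ?case by (intro exI[of _ "[]"]) (auto intro: word_cong.refl)
next
  case (Cons x b w)
  then obtain ss where ss: "distinct_adj (map fst ss)" "0 \<notin> snd ` set ss"
    "(w, syllable_word ss) \<in> word_cong A R" by blast
  define c :: int where "c = (if b then 1 else -1)"
  have 1: "((x, b) # w, (x, b) # syllable_word ss) \<in> word_cong A R"
    using ss Cons.hyps by (intro word_cong_Cons) auto
  show ?case
  proof (cases "\<exists>e ss'. ss = (x, e) # ss'")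
    case True
    then obtain e ss' where ss': "ss = (x, e) # ss'" by auto
    have "syllable_word ss \<in> words A" using word_cong_words[OF ss(3)] by simp
    then have "(((x, b) # power_word x e) @ syllable_word ss', power_word x (e + c) @ syllable_word ss')
        \<in> word_cong A R"
      unfolding c_def using Cons.hyps ss' by (intro word_cong.append power_word_step word_cong.refl) auto
    with 1 have 2: "((x, b) # w, power_word x (e + c) @ syllable_word ss') \<in> word_cong A R"
      using ss' by (auto intro: word_cong.trans)
    show ?thesis
    proof (cases "e + c = 0")
      case True
      then show ?thesis using 2 ss ss' by (intro exI[of _ ss']) (auto simp: distinct_adj_Cons)
    next
      case False
      then show ?thesis using 2 ss ss' 
        by (intro exI[of _ "(x, e + c) # ss'"]) (auto simp: distinct_adj_Cons)
    qed
  next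
    case False
    have "power_word x c = [(x, b)]" by (auto simp: c_def power_word_def)
    then show ?thesis using 1 False ss Cons.hyps
      by (intro exI[of _ "(x, c) # ss"]) (cases ss; auto simp: c_def distinct_adj_Cons)
  qed
qed

text \<open>
  Since \<open>(1 + x)\<^sup>e = 1 + e x + ...\<close>, a monomial \<open>x # xs\<close> in which \<open>x\<close> is not repeated sees only the
  terms of degree at most one of this binomial series.
\<close>

lemma magnus_power_word:
  shows "(xs = [] \<or> hd xs \<noteq> x) \<Longrightarrow> magnus (power_word x e) f xs = f xs"
    and "(xs = [] \<or> hd xs \<noteq> x) \<Longrightarrow> magnus (power_word x e) f (x # xs) = f (x # xs) + e * f xs"
proof -
  have *: "magnus (replicate n (x, b)) f xs = f xs \<and>
    magnus (replicate n (x, b)) f (x # xs) = f (x # xs) + (if b then 1 else -1) * int n * f xs"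
    if "xs = [] \<or> hd xs \<noteq> x" for n b
  proof (induction n)
    case (Suc n)
    have "magnus_letter (x, b) g xs = g xs" for g using that by (cases xs; cases b) auto
    then show ?case using Suc by (cases b) (auto simp: algebra_simps)
  qed auto
  show "(xs = [] \<or> hd xs \<noteq> x) \<Longrightarrow> magnus (power_word x e) f xs = f xs"
   and "(xs = [] \<or> hd xs \<noteq> x) \<Longrightarrow> magnus (power_word x e) f (x # xs) = f (x # xs) + e * f xs"
    using *[of "nat \<bar>e\<bar>" "e > 0"] by (auto simp: power_word_def abs_if)
qed

text \<open>
  In the product of \<open>k\<close> factors \<open>(1 + x)\<^sup>e\<close> a monomial without equal neighbours takes at most one
  variable from each factor. So it has length at most \<open>k\<close>, and the monomial listing the bases of all
  factors arises in exactly one way.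
\<close>

lemma magnus_syllable_word:
  assumes "distinct_adj (map fst ss)"
  shows "distinct_adj xs \<Longrightarrow> length xs > length ss \<Longrightarrow> magnus (syllable_word ss) one_series xs = 0"
    and "magnus (syllable_word ss) one_series (map fst ss) = prod_list (map snd ss)"
proof -
  have *: "(\<forall>xs. distinct_adj xs \<longrightarrow> length xs > length ss \<longrightarrow>
      magnus (syllable_word ss) one_series xs = 0) \<and>
    magnus (syllable_word ss) one_series (map fst ss) = prod_list (map snd ss)"
    using assms
  proof (induction ss)
    case Nil
    then show ?case by (auto simp: one_series_def)
  next
    case (Cons s ss)
    obtain x e where s: "s = (x, e)" by (cases s)
    define f where "f = magnus (syllable_word ss) one_series"
    have d: "distinct_adj (map fst ss)" using Cons.prems by (auto simp: distinct_adj_Cons)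
    have A: "f xs = 0" if "distinct_adj xs" "length xs > length ss" for xs
      using Cons.IH[OF d] that by (auto simp: f_def)
    have B: "f (map fst ss) = prod_list (map snd ss)" using Cons.IH[OF d] by (auto simp: f_def)
    have "magnus (power_word x e) f xs = 0" if xs: "distinct_adj xs" "length xs > Suc (length ss)" for xs
    proof (cases xs)
      case (Cons y ys)
      show ?thesis
      proof (cases "y = x")
        case True
        have "ys = [] \<or> hd ys \<noteq> x" using xs Cons True by (cases ys) (auto simp: distinct_adj_Cons)
        then show ?thesis
          using magnus_power_word(2)[of ys x e f] A[of xs] A[of ys] xs Cons True
          by (auto simp: distinct_adj_Cons)
      next
        case False
        then show ?thesis using magnus_power_word(1)[of xs x e f] A[of xs] xs Cons by auto
      qed
    qed (use that in auto)
    moreover have "magnus (power_word x e) f (x # map fst ss) = e * prod_list (map snd ss)"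
    proof -
      have "map fst ss = [] \<or> hd (map fst ss) \<noteq> x"
        using Cons.prems s by (cases ss) (auto simp: distinct_adj_Cons)
      then show ?thesis
        using magnus_power_word(2)[of "map fst ss" x e f] A[of "x # map fst ss"] B Cons.prems s by simp
    qed
    ultimately show ?case using s by (simp add: f_def)
  qed
  show "distinct_adj xs \<Longrightarrow> length xs > length ss \<Longrightarrow> magnus (syllable_word ss) one_series xs = 0"
    and "magnus (syllable_word ss) one_series (map fst ss) = prod_list (map snd ss)"
    using * by auto
qed

theorem magnus_faithful:
  assumes "w \<in> words A" "magnus w one_series = one_series"
  shows "(w, []) \<in> word_cong A {}"
proof -
  obtain ss where ss: "distinct_adj (map fst ss)" "0 \<notin> snd ` set ss"
    "(w, syllable_word ss) \<in> word_cong A {}"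
    using syllable_form_exists[OF assms(1), of "{}"] by auto
  have "one_series (map fst ss) = prod_list (map snd ss)"
    using magnus_syllable_word(2)[OF ss(1)] magnus_cong[OF ss(3)] assms(2) by simp
  moreover have "prod_list (map snd ss) \<noteq> 0" using ss(2) by (simp add: prod_list_zero_iff)
  ultimately have "ss = []" by (auto simp: one_series_def split: if_splits)
  then show ?thesis using ss(3) by simp
qed

subsection \<open>Linear independence in the abelianisation\<close>

text \<open>
  Multiplication by \<open>magnus (u i) - 1\<close>, whose lowest term is linear with coefficients the exponent
  sums of \<open>u i\<close>.
\<close>

definition word_shift :: "('i \<Rightarrow> 'b word) \<Rightarrow> 'i \<Rightarrow> ('b list \<Rightarrow> int) \<Rightarrow> 'b list \<Rightarrow> int"
  where "word_shift u i f xs = magnus (u i) f xs - f xs"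

text \<open>
  The series obtained from the monomial \<open>is\<close> by substituting \<open>magnus (u i) - 1\<close> for each variable
  \<open>i\<close>.
\<close>

definition word_monomial :: "('i \<Rightarrow> 'b word) \<Rightarrow> 'i list \<Rightarrow> 'b list \<Rightarrow> int"
  where "word_monomial u is = foldr (word_shift u) is one_series"

lemma word_monomial_simps [simp]:
  "word_monomial u [] = one_series"
  "word_monomial u (i # is) = word_shift u i (word_monomial u is)"
  by (auto simp: word_monomial_def)

lemma word_monomial_low: "length xs < length is \<Longrightarrow> word_monomial u is xs = 0"
proof (induction "is" arbitrary: xs)
  case (Cons i "is")
  then show ?case
    using magnus_leading(1)[of "length is" "word_monomial u is" xs "u i"] by (auto simp: word_shift_def)
qed auto

lemma word_monomial_leading:
  "length xs = length is \<Longrightarrow>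
    word_monomial u is xs = prod_list (map2 (\<lambda>i x. exp_sum x (u i)) is xs)"
proof (induction "is" arbitrary: xs)
  case (Cons i "is")
  then obtain y ys where "xs = y # ys" "length ys = length is" by (cases xs) auto
  then show ?case
    using magnus_leading(2)[of "length is" "word_monomial u is" ys "u i" y] Cons.IH[of ys]
    by (auto simp: word_shift_def word_monomial_low)
qed auto

definition bounded_lists :: "'i set \<Rightarrow> nat \<Rightarrow> 'i list set"
  where "bounded_lists I n = {is. set is \<subseteq> I \<and> length is \<le> n}"

lemma finite_bounded_lists: "finite I \<Longrightarrow> finite (bounded_lists I n)"
  unfolding bounded_lists_def by (rule finite_lists_length_le)

text \<open>
  The substitution extended from monomials to the series \<open>a\<close>. A monomial of length \<open>n\<close> contributes in
  degrees at least \<open>n\<close> only, which makes the sum finite in each degree.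
\<close>

definition monomial_expansion ::
    "'i set \<Rightarrow> ('i \<Rightarrow> 'b word) \<Rightarrow> ('i list \<Rightarrow> int) \<Rightarrow> 'b list \<Rightarrow> int"
  where "monomial_expansion I u a xs =
    (\<Sum>is\<in>bounded_lists I (length xs). a is * word_monomial u is xs)"

text \<open>
  The cut-off depends on the degree looked at; this lemma allows one cut-off for several degrees.
\<close>

lemma monomial_expansion_extend:
  assumes "finite I" "length xs \<le> n"
  shows "monomial_expansion I u a xs = (\<Sum>is\<in>bounded_lists I n. a is * word_monomial u is xs)"
  unfolding monomial_expansion_def
  using assms by (intro sum.mono_neutral_left finite_bounded_lists)
    (auto simp: bounded_lists_def not_le intro!: word_monomial_low)

lemma magnus_monomial_expansion:
  assumes "finite I" "i \<in> I"
  shows "magnus (u i) (monomial_expansion I u a) = monomial_expansion I u (magnus_letter (i, True) a)"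
proof
  fix xs :: "'b list"
  define L where "L = bounded_lists I (length xs)"
  have L: "finite L" using assms by (simp add: L_def finite_bounded_lists)
  have "magnus (u i) (monomial_expansion I u a) xs =
      magnus (u i) (\<lambda>zs. \<Sum>is\<in>L. a is * word_monomial u is zs) xs"
    using assms by (intro magnus_local) (auto simp: L_def monomial_expansion_extend)
  also have "\<dots> = (\<Sum>is\<in>L. a is * magnus (u i) (word_monomial u is) xs)"
    by (simp add: magnus_sum)
  also have "\<dots> = (\<Sum>is\<in>L. a is * word_monomial u is xs) + (\<Sum>is\<in>L. a is * word_monomial u (i # is) xs)"
    by (simp add: word_shift_def algebra_simps flip: sum.distrib)
  also have "(\<Sum>is\<in>L. a is * word_monomial u (i # is) xs) =
      (\<Sum>js\<in>(#) i ` L. a (tl js) * word_monomial u js xs)"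
    by (subst sum.reindex) auto
  also have "\<dots> = (\<Sum>js\<in>{js \<in> L. js \<noteq> [] \<and> hd js = i}. a (tl js) * word_monomial u js xs)"
  proof (rule sum.mono_neutral_right)
    show "{js \<in> L. js \<noteq> [] \<and> hd js = i} \<subseteq> (#) i ` L"
    proof
      fix js assume "js \<in> {js \<in> L. js \<noteq> [] \<and> hd js = i}"
      then have "js = i # tl js" "tl js \<in> L" by (cases js; auto simp: L_def bounded_lists_def)+
      then show "js \<in> (#) i ` L" by blast
    qed
    show "\<forall>js\<in>(#) i ` L - {js \<in> L. js \<noteq> [] \<and> hd js = i}. a (tl js) * word_monomial u js xs = 0"
      using assms(2) by (auto simp: L_def bounded_lists_def not_le less_Suc_eq_le
          simp del: word_monomial_simps(2) intro!: word_monomial_low)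
  qed (use L in auto)
  also have "\<dots> = (\<Sum>js\<in>L. (if js \<noteq> [] \<and> hd js = i then a (tl js) else 0) * word_monomial u js xs)"
    using L by (intro sum.mono_neutral_cong_left) auto
  also have "(\<Sum>is\<in>L. a is * word_monomial u is xs) + \<dots> =
      (\<Sum>is\<in>L. magnus_letter (i, True) a is * word_monomial u is xs)"
    unfolding sum.distrib[symmetric]
  proof (rule sum.cong[OF HOL.refl])
    fix js
    show "a js * word_monomial u js xs + (if js \<noteq> [] \<and> hd js = i then a (tl js) else 0) * word_monomial u js xs
      = magnus_letter (i, True) a js * word_monomial u js xs"
      by (cases js) (auto simp: algebra_simps simp del: word_monomial_simps(2))
  qed
  also have "\<dots> = monomial_expansion I u (magnus_letter (i, True) a) xs"
    by (simp add: monomial_expansion_def L_def)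
  finally show "magnus (u i) (monomial_expansion I u a) xs =
    monomial_expansion I u (magnus_letter (i, True) a) xs" .
qed

text \<open>
  Substituting words for letters corresponds to substituting their expansions for the variables. For
  an inverse letter this is reduced to the positive letter by multiplying with the expansion of
  \<open>u i\<close>, which is invertible.
\<close>

theorem magnus_subst_word:
  assumes "finite I" "p \<in> words I" "\<And>i. i \<in> I \<Longrightarrow> u i \<in> words B"
  shows "magnus (subst_word u p) one_series = monomial_expansion I u (magnus p one_series)"
  using assms(2)
proof (induction p rule: words_induct)
  case Nil
  have "monomial_expansion I u one_series xs = (\<Sum>is\<in>{[]}. one_series is * word_monomial u is xs)" for xs
    unfolding monomial_expansion_def
    by (intro sum.mono_neutral_right finite_bounded_lists[OF assms(1)])
      (auto simp: bounded_lists_def one_series_def)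
  then show ?case by (auto simp: fun_eq_iff)
next
  case (Cons i b p)
  show ?case
  proof (cases b)
    case True
    then show ?thesis
      using Cons magnus_monomial_expansion[OF assms(1) Cons.hyps(1), of u "magnus p one_series"] by simp
  next
    case False
    define a where "a = magnus ((i, False) # p) one_series"
    have "magnus_letter (i, True) a = magnus p one_series"
      using magnus_letter_cancel[of i True] by (simp add: a_def)
    then have "magnus (u i) (monomial_expansion I u a) = magnus (subst_word u p) one_series"
      using magnus_monomial_expansion[OF assms(1) Cons.hyps(1), of u a] Cons.IH by simp
    then have "magnus (inv_word (u i) @ u i) (monomial_expansion I u a) =
        magnus (subst_word u ((i, b) # p)) one_series"
      using False by simp
    moreover have "magnus (inv_word (u i) @ u i) f = f" for f
      using magnus_cong[OF word_cong_inv_left[OF assms(3)[OF Cons.hyps(1)]]] by simp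
    ultimately show ?thesis by (simp add: a_def False)
  qed
qed

definition linearly_independent :: "'i set \<Rightarrow> ('i \<Rightarrow> 'b \<Rightarrow> int) \<Rightarrow> bool"
  where "linearly_independent I l \<longleftrightarrow>
    (\<forall>a. (\<forall>x. (\<Sum>i\<in>I. a i * l i x) = 0) \<longrightarrow> (\<forall>i\<in>I. a i = 0))"

text \<open>
  Tensor powers of an injective linear map are injective. Concretely, for fixed remaining coordinates
  a relation among tensors of degree \<open>Suc n\<close> is a linear relation among the first factors; its
  coefficients therefore vanish, and they are themselves relations of degree \<open>n\<close>.
\<close>

lemma tensor_powers_independent:
  assumes "finite I" "linearly_independent I l"
    and "\<And>xs. length xs = n \<Longrightarrow>
      (\<Sum>is | set is \<subseteq> I \<and> length is = n. a is * prod_list (map2 l is xs)) = 0"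
    and "set is \<subseteq> I" "length is = n"
  shows "a is = 0"
  using assms(3-5)
proof (induction n arbitrary: a "is")
  case 0
  have "{js. set js \<subseteq> I \<and> length js = 0} = {[]}" by auto
  then show ?case using 0 by auto
next
  case (Suc n)
  let ?L = "\<lambda>n. {js. set js \<subseteq> I \<and> length js = n}"
  obtain j js where is_eq: "is = j # js" using Suc.prems by (cases "is") auto
  have split: "(\<Sum>is\<in>?L (Suc n). g is) = (\<Sum>i\<in>I. \<Sum>js\<in>?L n. g (i # js))" for g :: "'a list \<Rightarrow> int"
  proof -
    have "?L (Suc n) = (\<lambda>(i, js). i # js) ` (I \<times> ?L n)"
    proof (intro equalityI subsetI)
      fix ks assume "ks \<in> ?L (Suc n)"
      then have "ks = (\<lambda>(i, js). i # js) (hd ks, tl ks)" "(hd ks, tl ks) \<in> I \<times> ?L n"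
        by (cases ks; auto)+
      then show "ks \<in> (\<lambda>(i, js). i # js) ` (I \<times> ?L n)" by (rule image_eqI)
    qed auto
    moreover have "inj_on (\<lambda>(i, js). i # js) (I \<times> ?L n)" by (auto simp: inj_on_def)
    ultimately show ?thesis by (simp add: sum.reindex sum.cartesian_product split_def)
  qed
  have "(\<Sum>js\<in>?L n. a (i # js) * prod_list (map2 l js xs)) = 0" if i: "i \<in> I" and xs: "length xs = n" for i xs
  proof -
    have "(\<Sum>i\<in>I. (\<Sum>js\<in>?L n. a (i # js) * prod_list (map2 l js xs)) * l i x) = 0" for x
    proof -
      have "(\<Sum>is\<in>?L (Suc n). a is * prod_list (map2 l is (x # xs))) = 0"
        using Suc.prems(1)[of "x # xs"] xs by simp
      then show ?thesis unfolding split by (simp add: sum_distrib_left sum_distrib_right mult_ac)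
    qed
    with assms(2)[unfolded linearly_independent_def, rule_format,
        of "\<lambda>i. \<Sum>js\<in>?L n. a (i # js) * prod_list (map2 l js xs)" i] i
    show ?thesis by blast
  qed
  from Suc.IH[of "\<lambda>js. a (j # js)" js, OF this] Suc.prems is_eq show ?case by auto
qed

text \<open>
  Let \<open>d > 0\<close> be the lowest degree in which the expansion of \<open>p\<close> has a nonzero coefficient. The
  degree \<open>d\<close> part of the expansion of the substituted word is the image of that part under the
  \<open>d\<close>-th tensor power of the exponent vectors, hence nonzero, whereas the substituted word is
  trivial. So there is no such \<open>d\<close>, and \<open>magnus_faithful\<close> applies.
\<close>

theorem linearly_independent_imp_word_trivial:
  assumes I: "finite I" and lin: "linearly_independent I (\<lambda>i x. exp_sum x (u i))"
    and u: "\<And>i. i \<in> I \<Longrightarrow> u i \<in> words B"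
    and p: "p \<in> words I" and triv: "(subst_word u p, []) \<in> word_cong B {}"
  shows "(p, []) \<in> word_cong I {}"
proof -
  define a where "a = magnus p one_series"
  have exp: "monomial_expansion I u a = one_series"
    using magnus_subst_word[OF I p, of u B] u magnus_cong[OF triv] by (simp add: a_def)
  have a_Nil: "a [] = 1"
    using magnus_leading(1)[of 0 one_series "[]" p] by (simp add: a_def)
  have zero: "a is = 0" if "set is \<subseteq> I" "is \<noteq> []" for "is"
    using that
  proof (induction "length is" arbitrary: "is" rule: less_induct)
    case less
    define n where "n = length is"
    have "(\<Sum>is | set is \<subseteq> I \<and> length is = n. a is * prod_list (map2 (\<lambda>i x. exp_sum x (u i)) is xs)) = 0"
      if xs: "length xs = n" for xs
    proof -
      have "xs \<noteq> []" using xs less by (auto simp: n_def)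
      then have "0 = monomial_expansion I u a xs" by (simp add: exp one_series_def)
      also have "\<dots> = (\<Sum>is | set is \<subseteq> I \<and> length is = n. a is * word_monomial u is xs)"
        unfolding monomial_expansion_def
      proof (intro sum.mono_neutral_right finite_bounded_lists I ballI)
        fix js assume js: "js \<in> bounded_lists I (length xs) - {is. set is \<subseteq> I \<and> length is = n}"
        then have "length js < length is" "set js \<subseteq> I" using xs by (auto simp: bounded_lists_def n_def)
        then have "js = [] \<or> a js = 0" using less.hyps by blast
        then show "a js * word_monomial u js xs = 0" using \<open>xs \<noteq> []\<close> by (auto simp: one_series_def)
      qed (use xs in \<open>auto simp: bounded_lists_def\<close>)
      also have "\<dots> = (\<Sum>is | set is \<subseteq> I \<and> length is = n.
          a is * prod_list (map2 (\<lambda>i x. exp_sum x (u i)) is xs))"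
        using xs by (intro sum.cong) (auto simp: word_monomial_leading)
      finally show ?thesis by simp
    qed
    from tensor_powers_independent[OF I lin this less.prems(1) n_def[symmetric]] show ?case .
  qed
  have outside: "magnus p one_series is = 0" if "\<not> set is \<subseteq> I" for "is"
    using p that
  proof (induction p arbitrary: "is" rule: words_induct)
    case Nil
    then show ?case by (auto simp: one_series_def)
  next
    case (Cons i b p)
    have "magnus_letter (i, b) (magnus p one_series) js = 0" if "\<not> set js \<subseteq> I" for js
      using that
    proof (induction js)
      case (Cons k js)
      then show ?case using \<open>i \<in> I\<close> Cons.IH \<open>\<And>is. \<not> set is \<subseteq> I \<Longrightarrow> magnus p one_series is = 0\<close>
        by (cases b) auto
    qed auto
    then show ?case using Cons.prems by simp
  qed
  have "a = one_series"
    using a_Nil zero outside by (auto simp: fun_eq_iff one_series_def a_def)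
  with magnus_faithful[OF p] show ?thesis by (simp add: a_def)
qed

section \<open>Subgroups of free groups are free\<close>

context group
begin

lemma eval_word_snoc:
  assumes "u @ [(x, b)] \<in> words A" "f \<in> A \<rightarrow> carrier G"
  shows "eval_word G f (u @ [(x, b)]) = eval_word G f u \<otimes> (if b then f x else inv f x)"
  using assms by (auto simp: eval_word_append[of _ A] Pi_iff)

text \<open>
  Well-order the letters and take in each right coset of \<open>W\<close> the word that is least in the
  length-lexicographic order. An initial segment of a least word is again least in its coset, because
  a smaller competitor would stay smaller, and in the right coset, after appending the last letter.
\<close>

lemma schreier_transversal_exists:
  assumes f: "f \<in> A \<rightarrow> carrier G" and gen: "generate G (f ` A) = carrier G" and W: "subgroup W G"
  obtains \<rho> :: "'a \<Rightarrow> 'g word"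
  where "\<And>g. g \<in> carrier G \<Longrightarrow> \<rho> g \<in> words A"
    and "\<And>g. g \<in> carrier G \<Longrightarrow> eval_word G f (\<rho> g) \<otimes> inv g \<in> W"
    and "\<And>g w. g \<in> carrier G \<Longrightarrow> w \<in> W \<Longrightarrow> \<rho> (w \<otimes> g) = \<rho> g"
    and "\<And>g u l. g \<in> carrier G \<Longrightarrow> \<rho> g = u @ [l] \<Longrightarrow> \<rho> (eval_word G f u) = u"
    and "\<rho> \<one> = []"
proof -
  interpret W: subgroup W G by (rule W)
  obtain r :: "('g \<times> bool) rel" where r: "Well_order r" "Field r = UNIV"
    using well_ordering by metis
  define R where "R = lenlex (r - Id)"
  have wfR: "wf R" unfolding R_def using r by (auto simp: well_order_on_def)
  have "total (r - Id)"
    using r by (auto simp: well_order_on_def linear_order_on_def total_on_def)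
  then have totR: "(u, v) \<in> R \<or> (v, u) \<in> R" if "u \<noteq> v" for u v
    using total_lenlex[of "r - Id"] that by (auto simp: R_def total_on_def)
  define C where "C g = {w \<in> words A. eval_word G f w \<otimes> inv g \<in> W}" for g
  define least where "least g w \<longleftrightarrow> w \<in> C g \<and> (\<forall>u\<in>C g. (u, w) \<notin> R)" for g w
  have ex: "\<exists>w. least g w" if "g \<in> carrier G" for g
  proof -
    obtain w where "w \<in> words A" "g = eval_word G f w"
      using \<open>g \<in> carrier G\<close> gen generate_eq_eval_words[OF f] by auto
    then have "w \<in> C g" using that by (auto simp: C_def)
    with wfR obtain z where "z \<in> C g" "\<And>y. (y, z) \<in> R \<Longrightarrow> y \<notin> C g" by (rule wfE_min) auto
    then show ?thesis by (auto simp: least_def)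
  qed
  have unique: "u = v" if "least g u" "least g v" for g u v
    using that totR[of u v] by (auto simp: least_def)
  define \<rho> where "\<rho> g = (THE w. least g w)" for g
  have rho: "least g (\<rho> g)" if "g \<in> carrier G" for g
    unfolding \<rho>_def using ex[OF that] unique by (metis theI)
  have rho_eq: "\<rho> g = u" if "least g u" for g u
    unfolding \<rho>_def using that unique by blast
  show ?thesis
  proof (rule that)
    fix g assume g: "g \<in> carrier G"
    show "\<rho> g \<in> words A" "eval_word G f (\<rho> g) \<otimes> inv g \<in> W"
      using rho[OF g] by (auto simp: least_def C_def)
    show "\<rho> (w \<otimes> g) = \<rho> g" if w: "w \<in> W" for w
    proof -
      have "eval_word G f v \<otimes> inv (w \<otimes> g) \<in> W \<longleftrightarrow> eval_word G f v \<otimes> inv g \<in> W" if "v \<in> words A" for v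
      proof -
        have v: "eval_word G f v \<in> carrier G" using that f by auto
        have "eval_word G f v \<otimes> inv (w \<otimes> g) = (eval_word G f v \<otimes> inv g) \<otimes> inv w"
          using v g w by (simp add: inv_mult_group m_assoc)
        moreover have "(eval_word G f v \<otimes> inv g) \<otimes> inv w \<in> W \<longleftrightarrow> eval_word G f v \<otimes> inv g \<in> W"
        proof
          assume "(eval_word G f v \<otimes> inv g) \<otimes> inv w \<in> W"
          then have "((eval_word G f v \<otimes> inv g) \<otimes> inv w) \<otimes> w \<in> W" using w by blast
          then show "eval_word G f v \<otimes> inv g \<in> W" using v g w by (simp add: m_assoc)
        qed (use w in auto)
        ultimately show ?thesis by simp
      qed
      then have "C (w \<otimes> g) = C g" by (auto simp: C_def)
      then show ?thesis by (simp add: \<rho>_def least_def)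
    qed
    show "\<rho> (eval_word G f u) = u" if u: "\<rho> g = u @ [l]" for u l
    proof (rule rho_eq)
      obtain x b where l: "l = (x, b)" by (cases l)
      have ul: "u @ [(x, b)] \<in> words A" "eval_word G f (u @ [(x, b)]) \<otimes> inv g \<in> W"
        and least: "\<And>v. v \<in> C g \<Longrightarrow> (v, u @ [l]) \<notin> R"
        using rho[OF g] u l by (auto simp: least_def C_def)
      have x: "x \<in> A" "f x \<in> carrier G" and uw: "u \<in> words A" and uc: "eval_word G f u \<in> carrier G"
        using ul f by auto
      show "least (eval_word G f u) u"
        unfolding least_def
      proof (intro conjI ballI notI)
        show "u \<in> C (eval_word G f u)" using uw uc by (auto simp: C_def)
        fix v assume v: "v \<in> C (eval_word G f u)" and less: "(v, u) \<in> R"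
        define y where "y = (if b then f x else inv f x)"
        have y: "y \<in> carrier G" using x by (simp add: y_def)
        have vw: "v \<in> words A" "eval_word G f v \<in> carrier G" "eval_word G f v \<otimes> inv (eval_word G f u) \<in> W"
          using v f by (auto simp: C_def)
        have "eval_word G f (v @ [l]) \<otimes> inv g =
          (eval_word G f v \<otimes> inv (eval_word G f u)) \<otimes> (eval_word G f (u @ [(x, b)]) \<otimes> inv g)"
        proof -
          have "eval_word G f (v @ [l]) = eval_word G f v \<otimes> y"
            unfolding l y_def using vw x by (intro eval_word_snoc[OF _ f]) auto
          moreover have "eval_word G f (u @ [(x, b)]) = eval_word G f u \<otimes> y"
            unfolding y_def by (rule eval_word_snoc[OF ul(1) f])
          moreover have "inv (eval_word G f u) \<otimes> (eval_word G f u \<otimes> (y \<otimes> inv g)) = y \<otimes> inv g"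
            using y uc g by (simp flip: m_assoc)
          ultimately show ?thesis using y vw uc g by (simp add: m_assoc)
        qed
        then have "v @ [l] \<in> C g" using vw ul x l by (auto simp: C_def)
        moreover have "(v @ [l], u @ [l]) \<in> R"
          unfolding R_def by (rule lenlex_append1) (use less in \<open>auto simp: R_def\<close>)
        ultimately show False using least by blast
      qed
    qed
  next
    show "\<rho> \<one> = []"
      by (rule rho_eq) (auto simp: least_def C_def R_def)
  qed
qed

end

locale schreier = group G + W: subgroup W G
  for G :: "('g, 'm) monoid_scheme" (structure) and W +
  fixes f :: "'x \<Rightarrow> 'g" and A :: "'x set" and \<rho> :: "'g \<Rightarrow> 'x word"
  assumes indep: "freely_independent G f A"
    and gens: "generate G (f ` A) = carrier G"
    and rep_words: "g \<in> carrier G \<Longrightarrow> \<rho> g \<in> words A"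
    and rep_coset: "g \<in> carrier G \<Longrightarrow> eval_word G f (\<rho> g) \<otimes> inv g \<in> W"
    and rep_eq: "g \<in> carrier G \<Longrightarrow> w \<in> W \<Longrightarrow> \<rho> (w \<otimes> g) = \<rho> g"
    and rep_prefix: "g \<in> carrier G \<Longrightarrow> \<rho> g = u @ [l] \<Longrightarrow> \<rho> (eval_word G f u) = u"
    and rep_one: "\<rho> \<one> = []"
begin

abbreviation ev :: "'x word \<Rightarrow> 'g" where "ev \<equiv> eval_word G f"

lemma f_closed: "f \<in> A \<rightarrow> carrier G" "x \<in> A \<Longrightarrow> f x \<in> carrier G"
  using indep by (auto simp: freely_independent_def)

lemma ev_closed [simp]: "w \<in> words A \<Longrightarrow> ev w \<in> carrier G"
  using f_closed by auto

text \<open>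
  The element of \<open>W\<close> that labels the edge from the coset of \<open>g\<close> along the generator \<open>x\<close> in the coset
  graph, relative to the tree formed by the chosen representatives.
\<close>

definition schreier_gen :: "'g \<Rightarrow> 'x \<Rightarrow> 'g"
  where "schreier_gen g x = ev (\<rho> g) \<otimes> f x \<otimes> inv (ev (\<rho> (g \<otimes> f x)))"

definition basis :: "'g set"
  where "basis = {schreier_gen g x | g x. g \<in> carrier G \<and> x \<in> A} - {\<one>}"

lemma schreier_gen_in: "g \<in> carrier G \<Longrightarrow> x \<in> A \<Longrightarrow> schreier_gen g x \<in> W"
proof -
  assume g: "g \<in> carrier G" and x: "x \<in> A"
  then have c: "f x \<in> carrier G" "ev (\<rho> g) \<in> carrier G" "ev (\<rho> (g \<otimes> f x)) \<in> carrier G"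
    using f_closed rep_words by auto
  have "(ev (\<rho> g) \<otimes> inv g) \<otimes> inv (ev (\<rho> (g \<otimes> f x)) \<otimes> inv (g \<otimes> f x)) \<in> W"
    using W.m_closed[OF rep_coset W.m_inv_closed[OF rep_coset]] g c by blast
  also have "(ev (\<rho> g) \<otimes> inv g) \<otimes> inv (ev (\<rho> (g \<otimes> f x)) \<otimes> inv (g \<otimes> f x)) =
     ev (\<rho> g) \<otimes> (inv g \<otimes> (g \<otimes> (f x \<otimes> inv (ev (\<rho> (g \<otimes> f x))))))"
    using g c by (simp add: inv_mult_group m_assoc)
  also have "\<dots> = schreier_gen g x"
    using g c by (simp add: schreier_gen_def m_assoc[symmetric])
  finally show ?thesis .
qed

lemma basis_subset: "basis \<subseteq> W"
  using schreier_gen_in by (auto simp: basis_def)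

lemma schreier_gen_eq:
  "g \<in> carrier G \<Longrightarrow> x \<in> A \<Longrightarrow> w \<in> W \<Longrightarrow> schreier_gen (w \<otimes> g) x = schreier_gen g x"
  using rep_eq[of g w] rep_eq[of "g \<otimes> f x" w] f_closed by (simp add: schreier_gen_def m_assoc)

abbreviation P where "P \<equiv> free_group_on basis"

sublocale P: group P by (rule group_free_group_on)

text \<open>
  Tree edges carry the label \<open>\<one>\<close>, which is left out of the basis and hence is read as the identity.
\<close>

definition letter :: "'g \<Rightarrow> 'g word set"
  where "letter b = (if b = \<one> then \<one>\<^bsub>P\<^esub> else word_class basis [(b, True)])"

lemma letter_closed [simp]: "g \<in> carrier G \<Longrightarrow> x \<in> A \<Longrightarrow> letter (schreier_gen g x) \<in> carrier P"
proof -
  assume "g \<in> carrier G" "x \<in> A"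
  then have "schreier_gen g x = \<one> \<or> schreier_gen g x \<in> basis" unfolding basis_def by blast
  then show "letter (schreier_gen g x) \<in> carrier P"
    by (auto simp: letter_def carrier_free_group_on one_free_group_on)
qed

text \<open>
  Reidemeister rewriting: the word is followed through the coset graph from the coset of \<open>g\<close>, and the
  labels of the edges traversed are multiplied in the free group on the labels.
\<close>

fun rewrite :: "'g \<Rightarrow> 'x word \<Rightarrow> 'g word set"
where
  "rewrite g [] = \<one>\<^bsub>P\<^esub>"
| "rewrite g ((x, True) # w) = letter (schreier_gen g x) \<otimes>\<^bsub>P\<^esub> rewrite (g \<otimes> f x) w"
| "rewrite g ((x, False) # w) =
    inv\<^bsub>P\<^esub> letter (schreier_gen (g \<otimes> inv f x) x) \<otimes>\<^bsub>P\<^esub> rewrite (g \<otimes> inv f x) w"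

lemma rewrite_closed [simp]:
  assumes "w \<in> words A" "g \<in> carrier G"
  shows "rewrite g w \<in> carrier P"
  using assms
proof (induction w arbitrary: g rule: words_induct)
  case (Cons x b w)
  then show ?case by (cases b) (auto simp: f_closed)
qed auto

lemma rewrite_append:
  assumes "u \<in> words A" "v \<in> words A" "g \<in> carrier G"
  shows "rewrite g (u @ v) = rewrite g u \<otimes>\<^bsub>P\<^esub> rewrite (g \<otimes> ev u) v"
  using assms(1,3)
proof (induction u arbitrary: g rule: words_induct)
  case (Cons x b w)
  then show ?case using assms(2) by (cases b) (auto simp: f_closed P.m_assoc m_assoc)
qed (use assms in auto)

lemma rewrite_cong:
  assumes "(u, v) \<in> word_cong A {}" "g \<in> carrier G"
  shows "rewrite g u = rewrite g v"
  using assms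
proof (induction arbitrary: g)
  case (append u u' v v')
  have "ev u = ev u'" using eval_word_cong[OF append(1) f_closed(1)] by simp
  then show ?case
    using append word_cong_words[OF append(1)] word_cong_words[OF append(2)] by (simp add: rewrite_append)
next
  case (cancel x b)
  then show ?case by (cases b) (auto simp: f_closed m_assoc P.m_assoc)
qed auto

lemma rewrite_left_mult:
  assumes "u \<in> words A" "g \<in> carrier G" "w \<in> W"
  shows "rewrite (w \<otimes> g) u = rewrite g u"
  using assms(1,2)
proof (induction u arbitrary: g rule: words_induct)
  case (Cons x b u)
  then show ?case using assms(3) by (cases b) (auto simp: f_closed schreier_gen_eq m_assoc)
qed auto

lemma rewrite_in_W: "u \<in> words A \<Longrightarrow> w \<in> W \<Longrightarrow> rewrite w u = rewrite \<one> u"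
  using rewrite_left_mult[of u \<one> w] by simp

lemma rewrite_inv:
  assumes "u \<in> words A" "g \<in> carrier G"
  shows "rewrite g (inv_word u) = inv\<^bsub>P\<^esub> rewrite (g \<otimes> inv (ev u)) u"
proof -
  have "rewrite (g \<otimes> inv (ev u)) u \<otimes>\<^bsub>P\<^esub> rewrite g (inv_word u) = rewrite (g \<otimes> inv (ev u)) (u @ inv_word u)"
    using assms by (simp add: rewrite_append m_assoc)
  also have "\<dots> = \<one>\<^bsub>P\<^esub>"
    using rewrite_cong[OF word_cong_inv_right[OF assms(1)], of "g \<otimes> inv (ev u)"] assms by simp
  finally show ?thesis
    using assms P.inv_equality[of "rewrite g (inv_word u)" "rewrite (g \<otimes> inv (ev u)) u"]
    by (metis P.inv_equality P.inv_inv ev_closed inv_closed inv_word_in_words m_closed rewrite_closed)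
qed

text \<open>
  By the prefix property, a representative is read along tree edges only.
\<close>

lemma rewrite_rep:
  assumes "\<rho> g = u" "g \<in> carrier G"
  shows "rewrite \<one> u = \<one>\<^bsub>P\<^esub>"
  using assms
proof (induction u arbitrary: g rule: rev_induct)
  case (snoc l u)
  obtain x b where l: "l = (x, b)" by (cases l)
  have ul: "u @ [(x, b)] \<in> words A" using rep_words[of g] snoc.prems l by auto
  then have u: "u \<in> words A" "x \<in> A" "ev u \<in> carrier G" "f x \<in> carrier G" using f_closed by auto
  have rep_u: "\<rho> (ev u) = u" using rep_prefix[of g u l] snoc.prems by simp
  have ev_ul: "ev (u @ [(x, b)]) = ev u \<otimes> (if b then f x else inv f x)"
    by (rule eval_word_snoc[OF ul f_closed(1)])
  have "ev (u @ [(x, b)]) \<otimes> inv g \<in> W" using rep_coset[of g] snoc.prems l by auto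
  then have "\<rho> ((ev (u @ [(x, b)]) \<otimes> inv g) \<otimes> g) = \<rho> g" using snoc.prems by (intro rep_eq) auto
  then have rep_ul: "\<rho> (ev (u @ [(x, b)])) = u @ [(x, b)]" using ul snoc.prems l by (simp add: m_assoc)
  have "rewrite \<one> (u @ [(x, b)]) = rewrite (ev u) [(x, b)]"
    using u rewrite_append[of u "[(x, b)]" \<one>] snoc.IH[OF rep_u] rewrite_closed[of "[(x, b)]" "ev u"]
    by simp
  also have "\<dots> = \<one>\<^bsub>P\<^esub>"
  proof (cases b)
    case True
    then have "schreier_gen (ev u) x = \<one>"
      using rep_u rep_ul ev_ul u by (simp add: schreier_gen_def)
    then show ?thesis using True by (simp add: letter_def)
  next
    case False
    then have "schreier_gen (ev u \<otimes> inv f x) x = \<one>"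
      using rep_u rep_ul ev_ul u by (simp add: schreier_gen_def m_assoc)
    then show ?thesis using False by (simp add: letter_def)
  qed
  finally show ?case by (simp add: l)
qed simp

text \<open>
  Go to the start of the edge through the tree, cross the edge, and return through the tree: only the
  crossing contributes a label.
\<close>

lemma basis_word_exists:
  assumes "b \<in> basis"
  shows "\<exists>w\<in>words A. ev w = b \<and> rewrite \<one> w = word_class basis [(b, True)]"
proof -
  obtain g x where g: "g \<in> carrier G" "x \<in> A" "b = schreier_gen g x" "b \<noteq> \<one>"
    using assms by (auto simp: basis_def)
  define h where "h = g \<otimes> f x"
  have c: "f x \<in> carrier G" "h \<in> carrier G" "\<rho> g \<in> words A" "\<rho> h \<in> words A"
    using g f_closed by (auto simp: h_def rep_words)
  have bc: "b \<in> carrier G" "b \<in> W" using g schreier_gen_in by auto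
  have ev1: "ev (\<rho> g @ [(x, True)]) = b \<otimes> ev (\<rho> h)"
    using g(2,3) c by (simp add: eval_word_snoc[OF _ f_closed(1)] schreier_gen_def h_def m_assoc)
  have "ev (\<rho> g @ [(x, True)] @ inv_word (\<rho> h)) = ev (\<rho> g @ [(x, True)]) \<otimes> ev (inv_word (\<rho> h))"
    using eval_word_append[of "\<rho> g @ [(x, True)]" A "inv_word (\<rho> h)" f] c g f_closed by simp
  also have "\<dots> = b"
    using ev1 c bc by (simp add: eval_word_inv[OF _ f_closed(1)] m_assoc)
  finally have 1: "ev (\<rho> g @ [(x, True)] @ inv_word (\<rho> h)) = b" .
  have "rewrite \<one> ((\<rho> g @ [(x, True)]) @ inv_word (\<rho> h)) =
      rewrite \<one> (\<rho> g @ [(x, True)]) \<otimes>\<^bsub>P\<^esub> rewrite (b \<otimes> ev (\<rho> h)) (inv_word (\<rho> h))"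
    using c g ev1 bc by (subst rewrite_append) auto
  also have "rewrite (b \<otimes> ev (\<rho> h)) (inv_word (\<rho> h)) = \<one>\<^bsub>P\<^esub>"
    using c bc rewrite_inv[of "\<rho> h" "b \<otimes> ev (\<rho> h)"] rewrite_in_W[of "\<rho> h" b] rewrite_rep[of h]
    by (simp add: m_assoc)
  also have "rewrite \<one> (\<rho> g @ [(x, True)]) = letter (schreier_gen (ev (\<rho> g)) x)"
    using c g rewrite_rep[of g] by (simp add: rewrite_append)
  also have "schreier_gen (ev (\<rho> g)) x = b"
  proof -
    have "schreier_gen ((ev (\<rho> g) \<otimes> inv g) \<otimes> g) x = schreier_gen g x"
      using g rep_coset by (intro schreier_gen_eq) auto
    then show ?thesis using g c by (simp add: m_assoc)
  qed
  also have "letter b = word_class basis [(b, True)]" using g by (simp add: letter_def)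
  finally have 2: "rewrite \<one> (\<rho> g @ [(x, True)] @ inv_word (\<rho> h)) = word_class basis [(b, True)]"
    using assms by (simp add: carrier_free_group_on)
  show ?thesis
    using c g by (intro bexI[of _ "\<rho> g @ [(x, True)] @ inv_word (\<rho> h)"] conjI 1 2) auto
qed

text \<open>
  Rewriting is a left inverse of the substitution of the words from \<open>basis_word_exists\<close>, so a word
  with trivial value is itself trivial.
\<close>

lemma basis_independent: "freely_independent G (\<lambda>g. g) basis"
  unfolding freely_independent_def
proof (intro conjI ballI impI)
  show id: "(\<lambda>g. g) \<in> basis \<rightarrow> carrier G" using basis_subset W.subset by auto
  obtain r where r: "\<And>b. b \<in> basis \<Longrightarrow> r b \<in> words A" "\<And>b. b \<in> basis \<Longrightarrow> ev (r b) = b"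
    "\<And>b. b \<in> basis \<Longrightarrow> rewrite \<one> (r b) = word_class basis [(b, True)]"
    using basis_word_exists by metis
  have rewrite_subst: "rewrite \<one> (subst_word r q) = word_class basis q" if "q \<in> words basis" for q
    using that
  proof (induction q rule: words_induct)
    case Nil
    show ?case by (simp add: one_free_group_on)
  next
    case (Cons b c q)
    have q: "subst_word r q \<in> words A" using Cons r by (intro subst_word_in_words) auto
    have bW: "b \<in> W" by (rule subsetD[OF basis_subset Cons.hyps(1)])
    then have b: "b \<in> W" "b \<in> carrier G" "inv b \<in> W" by simp_all
    have "rewrite \<one> (if c then r b else inv_word (r b)) = word_class basis [(b, c)]"
    proof (cases c)
      case False
      have "rewrite \<one> (inv_word (r b)) = inv\<^bsub>P\<^esub> rewrite (inv b) (r b)"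
        using Cons r b by (simp add: rewrite_inv)
      also have "\<dots> = inv\<^bsub>P\<^esub> word_class basis [(b, True)]" using Cons r b by (simp add: rewrite_in_W[of _ "inv b"])
      finally show ?thesis using Cons False by (simp add: inv_word_class)
    qed (use Cons r in simp)
    moreover have "ev (if c then r b else inv_word (r b)) \<in> W"
      using Cons r b by (simp add: eval_word_inv[OF _ f_closed(1)])
    note rewrite_in_W[OF q this]
    ultimately show ?case
      using Cons r q by (simp add: rewrite_append word_class_mult split: if_splits)
  qed
  fix q assume q: "q \<in> words basis" "eval_word G (\<lambda>g. g) q = \<one>"
  have "ev (subst_word r q) = eval_word G (\<lambda>b. ev (r b)) q"
    using q r f_closed by (intro eval_word_subst) auto
  also have "\<dots> = \<one>" using q r eval_word_fun_cong[OF q(1), of "\<lambda>b. ev (r b)" "\<lambda>b. b"] by simp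
  moreover have "subst_word r q \<in> words A" using q r by (intro subst_word_in_words) auto
  ultimately have "(subst_word r q, []) \<in> word_cong A {}"
    using indep by (simp add: freely_independent_def)
  then have "rewrite \<one> (subst_word r q) = rewrite \<one> []" by (rule rewrite_cong) simp
  then have "word_class basis q = word_class basis []" 
    using rewrite_subst[OF q(1)] by (simp add: one_free_group_on)
  then show "(q, []) \<in> word_cong basis {}" using q by (simp add: word_class_eq_iff)
qed

text \<open>
  The labels along a path telescope: their product is the value of the path, up to the representatives
  of its two ends, which are trivial for a path from the coset \<open>W\<close> to itself.
\<close>

lemma basis_generates: "generate G basis = W"
proof
  show "generate G basis \<subseteq> W"
    using basis_subset W.subgroup_axioms by (rule generate_subgroup_incl)
  have sub: "subgroup (generate G basis) G"
    using basis_subset W.subset by (intro generate_is_subgroup) auto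
  interpret B: subgroup "generate G basis" G by (rule sub)
  have sg: "schreier_gen g x \<in> generate G basis" if "g \<in> carrier G" "x \<in> A" for g x
  proof (cases "schreier_gen g x = \<one>")
    case False
    then have "schreier_gen g x \<in> basis" using that unfolding basis_def by blast
    then show ?thesis by (rule generate.incl)
  qed simp
  have telescope: "ev (\<rho> g) \<otimes> ev w \<otimes> inv (ev (\<rho> (g \<otimes> ev w))) \<in> generate G basis"
    if "w \<in> words A" "g \<in> carrier G" for g w
    using that
  proof (induction w arbitrary: g rule: words_induct)
    case Nil
    then show ?case using rep_words by simp
  next
    case (Cons x b w)
    define y where "y = (if b then f x else inv f x)"
    have y: "y \<in> carrier G" "f x \<in> carrier G" using f_closed Cons by (auto simp: y_def)
    define h where "h = g \<otimes> y"
    define k where "k = h \<otimes> ev w"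
    have c: "ev (\<rho> g) \<in> carrier G" "ev (\<rho> h) \<in> carrier G" "ev (\<rho> k) \<in> carrier G"
      "h \<in> carrier G" "k \<in> carrier G" "ev w \<in> carrier G"
      using Cons y rep_words by (auto simp: h_def k_def)
    have "ev (\<rho> g) \<otimes> y \<otimes> inv (ev (\<rho> h)) \<in> generate G basis"
    proof (cases b)
      case True
      then show ?thesis using sg[of g x] Cons by (simp add: schreier_gen_def y_def h_def)
    next
      case False
      have "inv (schreier_gen h x) \<in> generate G basis" using sg[of h x] Cons c by blast
      then show ?thesis using c y Cons False
        by (simp add: schreier_gen_def y_def h_def inv_mult_group m_assoc)
    qed
    moreover have "ev (\<rho> h) \<otimes> ev w \<otimes> inv (ev (\<rho> k)) \<in> generate G basis"
      using Cons.IH[OF c(4)] by (simp add: k_def)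
    ultimately have "(ev (\<rho> g) \<otimes> y \<otimes> inv (ev (\<rho> h))) \<otimes> (ev (\<rho> h) \<otimes> ev w \<otimes> inv (ev (\<rho> k)))
        \<in> generate G basis" by blast
    also have "(ev (\<rho> g) \<otimes> y \<otimes> inv (ev (\<rho> h))) \<otimes> (ev (\<rho> h) \<otimes> ev w \<otimes> inv (ev (\<rho> k))) =
        ev (\<rho> g) \<otimes> (y \<otimes> (inv (ev (\<rho> h)) \<otimes> (ev (\<rho> h) \<otimes> (ev w \<otimes> inv (ev (\<rho> k))))))"
      using c y by (simp add: m_assoc)
    also have "inv (ev (\<rho> h)) \<otimes> (ev (\<rho> h) \<otimes> (ev w \<otimes> inv (ev (\<rho> k)))) = ev w \<otimes> inv (ev (\<rho> k))"
      using c by (simp flip: m_assoc)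
    also have "ev (\<rho> g) \<otimes> (y \<otimes> (ev w \<otimes> inv (ev (\<rho> k)))) =
        ev (\<rho> g) \<otimes> ev ((x, b) # w) \<otimes> inv (ev (\<rho> (g \<otimes> ev ((x, b) # w))))"
      using c y Cons by (simp add: m_assoc k_def h_def y_def)
    finally show ?case .
  qed
  show "W \<subseteq> generate G basis"
  proof
    fix g assume g: "g \<in> W"
    then obtain w where w: "w \<in> words A" "g = ev w"
      using gens generate_eq_eval_words[OF f_closed(1)] W.subset by blast
    have "\<rho> g = []" using rep_eq[of \<one> g] g rep_one by simp
    then show "g \<in> generate G basis" using telescope[OF w(1), of \<one>] w by (simp add: rep_one)
  qed
qed

end

theorem (in group) nielsen_schreier:
  assumes "freely_independent G f A" "generate G (f ` A) = carrier G" "subgroup W G"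
  obtains B where "freely_independent G (\<lambda>g. g) B" "generate G B = W"
proof -
  have f: "f \<in> A \<rightarrow> carrier G" using assms by (simp add: freely_independent_def)
  from schreier_transversal_exists[OF f assms(2,3)] obtain \<rho> where
    "\<And>g. g \<in> carrier G \<Longrightarrow> \<rho> g \<in> words A"
    "\<And>g. g \<in> carrier G \<Longrightarrow> eval_word G f (\<rho> g) \<otimes> inv g \<in> W"
    "\<And>g w. g \<in> carrier G \<Longrightarrow> w \<in> W \<Longrightarrow> \<rho> (w \<otimes> g) = \<rho> g"
    "\<And>g u l. g \<in> carrier G \<Longrightarrow> \<rho> g = u @ [l] \<Longrightarrow> \<rho> (eval_word G f u) = u"
    "\<rho> \<one> = []" by metis
  then interpret schreier G W f A \<rho>
    using assms by (intro schreier.intro schreier_axioms.intro is_group) auto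
  show ?thesis using that basis_independent basis_generates by blast
qed

section \<open>Orbits of an endomorphism of a free group\<close>

lemma linear_recurrence_zero:
  fixes a c :: "nat \<Rightarrow> int"
  assumes "\<And>k. (\<Sum>i\<le>m. a i * c (i + k)) = 0" "a m \<noteq> 0" "\<And>i. i < m \<Longrightarrow> c i = 0"
  shows "c j = 0"
proof (induction j rule: less_induct)
  case (less j)
  show ?case
  proof (cases "j < m")
    case False
    define k where "k = j - m"
    have "(\<Sum>i\<le>m. a i * c (i + k)) = (\<Sum>i<m. a i * c (i + k)) + a m * c (m + k)"
      by (simp flip: lessThan_Suc_atMost)
    also have "(\<Sum>i<m. a i * c (i + k)) = 0"
      using False by (intro sum.neutral ballI) (auto simp: k_def intro!: less.IH)
    finally have "a m * c (m + k) = 0" using assms(1)[of k] by simp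
    then show ?thesis using assms(2) False by (simp add: k_def)
  qed (use assms(3) in auto)
qed

context group
begin

lemma freely_independent_eval_eq:
  assumes "freely_independent G f A" "u \<in> words A" "v \<in> words A" "eval_word G f u = eval_word G f v"
  shows "(u, v) \<in> word_cong A {}"
proof -
  have f: "f \<in> A \<rightarrow> carrier G" using assms by (simp add: freely_independent_def)
  have "eval_word G f (u @ inv_word v) = \<one>"
    using assms f by (simp add: eval_word_append[of _ A] eval_word_inv[of _ A] eval_word_closed[of v A])
  then have "(u @ inv_word v, []) \<in> word_cong A {}"
    using assms by (simp add: freely_independent_def)
  from word_cong.append[OF this word_cong.refl[OF assms(3)]]
  have "(u @ (inv_word v @ v), v) \<in> word_cong A {}" by simp
  moreover have "(u @ (inv_word v @ v), u @ []) \<in> word_cong A {}"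
    using assms by (intro word_cong.append word_cong.refl word_cong_inv_left)
  ultimately show ?thesis by (metis append_Nil2 word_cong.sym word_cong.trans)
qed

text \<open>
  On exponent vectors the endomorphism \<open>\<psi>\<close> acts by the matrix with entries \<open>exp_sum x (U y)\<close>.
\<close>

lemma exp_sum_shift:
  assumes "freely_independent G (\<lambda>g. g) B" "\<psi> \<in> hom G G" "\<And>b. b \<in> B \<Longrightarrow> U b \<in> words B"
    and "\<And>b. b \<in> B \<Longrightarrow> eval_word G (\<lambda>g. g) (U b) = \<psi> b"
    and "w \<in> words B" "w' \<in> words B" "eval_word G (\<lambda>g. g) w' = \<psi> (eval_word G (\<lambda>g. g) w)"
    and "finite A" "fst ` set w \<subseteq> A"
  shows "exp_sum x w' = (\<Sum>y\<in>A. exp_sum y w * exp_sum x (U y))"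
proof -
  have id: "(\<lambda>g. g) \<in> B \<rightarrow> carrier G" using assms by (simp add: freely_independent_def)
  have "eval_word G (\<lambda>g. g) (subst_word U w) = eval_word G \<psi> w"
    using assms by (subst eval_word_subst[OF _ _ id]) (auto intro!: eval_word_fun_cong)
  also have "\<dots> = \<psi> (eval_word G (\<lambda>g. g) w)"
    using eval_word_hom[OF is_group assms(2,5) id] by simp
  finally have "(w', subst_word U w) \<in> word_cong B {}"
    using assms by (intro freely_independent_eval_eq[OF assms(1)]) (auto intro: subst_word_in_words)
  then show ?thesis
    using exp_sum_cong exp_sum_subst_word[OF assms(8) words_letters[OF assms(5,9)]] by metis
qed

text \<open>
  In the abelianisation of \<open>W\<close> the orbit is the sequence of exponent vectors of the words \<open>u i\<close>. If
  every initial segment is linearly independent, Magnus expansion shows that the orbit is freely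
  independent. Otherwise the vectors satisfy a linear recurrence, are supported on a finite set \<open>D\<close> of
  basis elements, and generate the abelianisation, so that \<open>D\<close> is the whole basis.
\<close>

theorem orbit_free_or_finitely_generated:
  fixes \<psi> :: "'a \<Rightarrow> 'a" and v :: 'a
  defines "orb \<equiv> \<lambda>i::nat. (\<psi> ^^ i) v"
  assumes "freely_independent G f A" "generate G (f ` A) = carrier G"
    and \<psi>: "\<psi> \<in> hom G G" and v: "v \<in> carrier G"
  shows "freely_independent G orb UNIV \<or>
    (\<exists>B. finite B \<and> B \<subseteq> carrier G \<and> generate G B = generate G (range orb))"
proof -
  have orb_closed: "orb i \<in> carrier G" for i
    unfolding orb_def using \<psi> v by (induction i) (auto simp: hom_def Pi_iff)
  have orb_Suc: "\<psi> (orb i) = orb (Suc i)" for i by (simp add: orb_def)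
  define W where "W = generate G (range orb)"
  have sub: "subgroup W G" unfolding W_def using orb_closed by (intro generate_is_subgroup) auto
  obtain B where B: "freely_independent G (\<lambda>g. g) B" "generate G B = W"
    using nielsen_schreier[OF assms(2,3) sub] by blast
  have id: "(\<lambda>g. g) \<in> B \<rightarrow> carrier G" using B by (simp add: freely_independent_def)
  interpret \<psi>: group_hom G G \<psi> using \<psi> by unfold_locales
  have "\<psi> ` W = generate G (\<psi> ` range orb)"
    unfolding W_def using orb_closed by (intro \<psi>.generate_img[symmetric]) auto
  also have "\<dots> \<subseteq> W"
    unfolding W_def by (intro mono_generate) (auto simp: orb_Suc)
  finally have \<psi>_W: "\<psi> g \<in> W" if "g \<in> W" for g using that by auto
  have orb_W: "orb i \<in> W" for i by (auto simp: W_def intro: generate.incl)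
  have B_W: "b \<in> W" if "b \<in> B" for b using that B(2) generate.incl[of b B G] by auto
  have W_eval: "W = eval_word G (\<lambda>g. g) ` words B"
    using generate_eq_eval_words[OF id] B by simp
  define r where "r g = (SOME w. w \<in> words B \<and> eval_word G (\<lambda>g. g) w = g)" for g
  have r: "r g \<in> words B" "eval_word G (\<lambda>g. g) (r g) = g" if "g \<in> W" for g
  proof -
    have "\<exists>w. w \<in> words B \<and> eval_word G (\<lambda>g. g) w = g" using that W_eval by auto
    from someI_ex[OF this] show "r g \<in> words B" "eval_word G (\<lambda>g. g) (r g) = g" by (auto simp: r_def)
  qed
  define u where "u i = r (orb i)" for i
  have u: "u i \<in> words B" "eval_word G (\<lambda>g. g) (u i) = orb i" for i
    using r[OF orb_W] by (auto simp: u_def)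
  show ?thesis
  proof (cases "\<forall>n. linearly_independent {..n} (\<lambda>i x. exp_sum x (u i))")
    case True
    have "freely_independent G orb UNIV"
      unfolding freely_independent_def
    proof (intro conjI ballI impI)
      show "orb \<in> UNIV \<rightarrow> carrier G" using orb_closed by auto
      fix w :: "nat word" assume w: "w \<in> words UNIV" "eval_word G orb w = \<one>"
      obtain n where n: "fst ` set w \<subseteq> {..n}"
        using finite_nat_set_iff_bounded_le[of "fst ` set w"] by auto
      then have wn: "w \<in> words {..n}" using w words_letters by blast
      have "eval_word G (\<lambda>g. g) (subst_word u w) = \<one>"
        using w u by (subst eval_word_subst[OF w(1) _ id]) auto
      moreover have "subst_word u w \<in> words B" using u w by (intro subst_word_in_words) auto
      ultimately have "(subst_word u w, []) \<in> word_cong B {}"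
        using B(1) by (simp add: freely_independent_def)
      with True have "(w, []) \<in> word_cong {..n} {}"
        using u wn by (intro linearly_independent_imp_word_trivial[of "{..n}" u B]) auto
      then show "(w, []) \<in> word_cong UNIV {}" by (rule word_cong_mono) auto
    qed
    then show ?thesis ..
  next
    case False
    then obtain n a where a0: "\<And>x. (\<Sum>i\<le>n. a i * exp_sum x (u i)) = 0" "\<exists>i\<le>n. a i \<noteq> 0"
      unfolding linearly_independent_def by auto
    \<comment> \<open>A nonzero leading coefficient turns the relation into a recurrence of order \<open>m\<close>.\<close>
    define m where "m = Max {i. i \<le> n \<and> a i \<noteq> 0}"
    have "m \<in> {i. i \<le> n \<and> a i \<noteq> 0}" unfolding m_def using a0(2) by (intro Max_in) auto
    moreover have "i \<le> m" if "i \<le> n" "a i \<noteq> 0" for i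
      unfolding m_def using that by (intro Max_ge) auto
    ultimately have m: "m \<le> n" "a m \<noteq> 0" "\<And>i. i \<le> n \<Longrightarrow> m < i \<Longrightarrow> a i = 0" by force+
    \<comment> \<open>The endomorphism carries the relation from the orbit elements \<open>k, ..., k + m\<close> to the next ones.\<close>
    have rec: "(\<Sum>i\<le>m. a i * exp_sum x (u (i + k))) = 0" for x k
    proof (induction k arbitrary: x)
      case 0
      have "(\<Sum>i\<le>m. a i * exp_sum x (u i)) = (\<Sum>i\<le>n. a i * exp_sum x (u i))"
        using m by (intro sum.mono_neutral_left) auto
      then show ?case using a0 by simp
    next
      case (Suc k)
      define L where "L = (\<Union>i\<le>m. fst ` set (u (i + k)))"
      have L: "finite L" by (simp add: L_def)
      have "exp_sum x (u (i + Suc k)) = (\<Sum>y\<in>L. exp_sum y (u (i + k)) * exp_sum x (r (\<psi> y)))"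
        if "i \<le> m" for i
      proof (rule exp_sum_shift[OF B(1) \<psi> _ _ u(1) u(1) _ L])
        show "fst ` set (u (i + k)) \<subseteq> L" using that by (auto simp: L_def)
      qed (use r \<psi>_W B_W u orb_Suc in auto)
      then have "(\<Sum>i\<le>m. a i * exp_sum x (u (i + Suc k))) =
          (\<Sum>i\<le>m. \<Sum>y\<in>L. a i * exp_sum y (u (i + k)) * exp_sum x (r (\<psi> y)))"
        by (intro sum.cong) (auto simp: sum_distrib_left mult_ac)
      also have "\<dots> = (\<Sum>y\<in>L. (\<Sum>i\<le>m. a i * exp_sum y (u (i + k))) * exp_sum x (r (\<psi> y)))"
        by (subst sum.swap) (simp add: sum_distrib_right)
      also have "\<dots> = 0" using Suc.IH by simp
      finally show ?case .
    qed
    define D where "D = (\<Union>i<m. fst ` set (u i))"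
    have "b \<in> D" if b: "b \<in> B" for b
    proof (rule ccontr)
      assume "b \<notin> D"
      then have "exp_sum b (u i) = 0" if "i < m" for i
        using that by (intro exp_sum_eq_0) (auto simp: D_def)
      then have zero: "exp_sum b (u i) = 0" for i
        using linear_recurrence_zero[OF rec m(2), of b i] by auto
      obtain p where p: "p \<in> words UNIV" "b = eval_word G orb p"
        using B_W[OF b] generate_eq_eval_words[of orb UNIV] orb_closed by (auto simp: W_def)
      have "eval_word G (\<lambda>g. g) (subst_word u p) = eval_word G (\<lambda>g. g) [(b, True)]"
        using p u id b by (subst eval_word_subst[OF p(1) _ id]) (auto simp: Pi_iff)
      then have "(subst_word u p, [(b, True)]) \<in> word_cong B {}"
        using p u b by (intro freely_independent_eval_eq[OF B(1)]) (auto intro: subst_word_in_words)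
      from exp_sum_cong[OF this, of b] show False
        using exp_sum_subst_word_eq_0[where p = p, OF zero] by simp
    qed
    moreover have "finite D" by (auto simp: D_def)
    ultimately have "finite B" using finite_subset[of B D] by auto
    then show ?thesis using B id by (auto simp: W_def)
  qed
qed

end

section \<open>Free pairs and changes of generators\<close>

text \<open>
  A word in \<open>s\<close> and \<open>y\<close> is read from level \<open>n\<close>, where \<open>s\<close> raises and \<open>s\<inverse>\<close> lowers the level; a letter
  \<open>y\<close> met at level \<open>n\<close> stands for the conjugate of \<open>y\<close> by \<open>s\<^sup>n\<close>. No level is negative if the starting
  level is at least the length of the word.
\<close>

fun conjugate_letters :: "'g \<Rightarrow> nat \<Rightarrow> 'g word \<Rightarrow> nat word"
where
  "conjugate_letters s n [] = []"
| "conjugate_letters s n ((x, b) # w) =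
    (if x = s then conjugate_letters s (if b then Suc n else n - 1) w
     else (n, b) # conjugate_letters s n w)"

definition conjugate_word :: "'g \<Rightarrow> 'g \<Rightarrow> nat \<Rightarrow> 'g word"
  where "conjugate_word s y i = replicate i (s, True) @ [(y, True)] @ replicate i (s, False)"

lemma word_cong_conjugate_letters:
  assumes "w \<in> words {s, y}" "s \<noteq> y" "length w \<le> n"
  shows "(replicate n (s, True) @ w,
    subst_word (conjugate_word s y) (conjugate_letters s n w) @
      replicate (nat (int n + exp_sum s w)) (s, True)) \<in> word_cong {s, y} {}"
  using assms(1,3)
proof (induction w arbitrary: n rule: words_induct)
  case Nil
  then show ?case by (auto intro: word_cong.refl)
next
  case (Cons x b w)
  consider "x = s" "b" | "x = s" "\<not> b" | "x = y" using Cons.hyps by blast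
  then show ?case
  proof cases
    case 1
    then have eq: "replicate n (s, True) @ (x, b) # w = replicate (Suc n) (s, True) @ w"
      by (simp add: replicate_app_Cons_same)
    show ?thesis
      unfolding eq using 1 Cons.IH[of "Suc n"] Cons.prems by (simp add: add_ac)
  next
    case 2
    obtain k where k: "n = Suc k" using Cons.prems by (cases n) auto
    have "replicate n (s, True) @ (x, b) # w = replicate k (s, True) @ (s, True) # (s, \<not> True) # w"
      using 2 by (simp add: k replicate_app_Cons_same)
    moreover have "(replicate k (s, True) @ (s, True) # (s, \<not> True) # w, replicate k (s, True) @ w)
        \<in> word_cong {s, y} {}"
      using Cons.hyps by (intro word_cong.append word_cong.refl word_cong_cancel_Cons) auto
    ultimately show ?thesis
      using 2 Cons.IH[of k] Cons.prems by (auto simp: k intro: word_cong.trans)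
  next
    case 3
    define c where "c = replicate n (s, True) @ [(y, b)] @ replicate n (s, False)"
    have cw: "c = (if b then conjugate_word s y n else inv_word (conjugate_word s y n))"
      by (simp add: c_def conjugate_word_def)
    have "((replicate n (s, True) @ [(y, b)]) @ (replicate n (s, False) @ inv_word (replicate n (s, False))) @ w,
       (replicate n (s, True) @ [(y, b)]) @ [] @ w) \<in> word_cong {s, y} {}"
      using Cons.hyps by (intro word_cong.append word_cong.refl word_cong_inv_right) auto
    then have 1: "(replicate n (s, True) @ (y, b) # w, c @ replicate n (s, True) @ w) \<in> word_cong {s, y} {}"
      by (simp add: c_def word_cong.sym)
    have "(c @ replicate n (s, True) @ w, c @ subst_word (conjugate_word s y) (conjugate_letters s n w) @
      replicate (nat (int n + exp_sum s w)) (s, True)) \<in> word_cong {s, y} {}"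
      using Cons.prems by (intro word_cong.append word_cong.refl Cons.IH) (auto simp: c_def)
    from word_cong.trans[OF 1 this] show ?thesis
      using 3 assms(2) by (simp add: cw)
  qed
qed

lemma word_cong_single_letter:
  "w \<in> words {s} \<Longrightarrow> (w, power_word s (exp_sum s w)) \<in> word_cong {s} {}"
proof (induction w rule: words_induct)
  case (Cons x b w)
  have "((x, b) # w, (x, b) # power_word s (exp_sum s w)) \<in> word_cong {s} {}"
    using Cons by (intro word_cong_Cons) auto
  also have "((x, b) # power_word s (exp_sum s w), power_word x (exp_sum s w + (if b then 1 else -1)))
      \<in> word_cong {s} {}"
    using Cons.hyps power_word_step[of s "{s}" b] by auto
  finally show ?case using Cons.hyps by (simp add: add.commute)
qed (auto intro: word_cong.refl)

context group
begin

lemma additive_eval_word: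
  fixes \<chi> :: "'a \<Rightarrow> int"
  assumes \<chi>: "\<And>g h. g \<in> carrier G \<Longrightarrow> h \<in> carrier G \<Longrightarrow> \<chi> (g \<otimes> h) = \<chi> g + \<chi> h"
    and A: "A \<subseteq> carrier G" "\<And>g. g \<in> A \<Longrightarrow> g \<noteq> s \<Longrightarrow> \<chi> g = 0" and w: "w \<in> words A"
  shows "\<chi> (eval_word G (\<lambda>g. g) w) = exp_sum s w * \<chi> s"
proof -
  have one: "\<chi> \<one> = 0" using \<chi>[of \<one> \<one>] by simp
  have inv: "\<chi> (inv g) = - \<chi> g" if "g \<in> carrier G" for g
    using \<chi>[of g "inv g"] that one by simp
  show ?thesis
    using w
  proof (induction w rule: words_induct)
    case (Cons x b w)
    have x: "x \<in> carrier G" and w: "eval_word G (\<lambda>g. g) w \<in> carrier G"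
      using Cons.hyps A(1) by auto
    show ?case
      using Cons.IH x w A(2)[OF Cons.hyps(1)] by (auto simp: \<chi> inv algebra_simps)
  qed (simp add: one)
qed

lemma freely_independent_single:
  fixes \<chi> :: "'a \<Rightarrow> int"
  assumes \<chi>: "\<And>g h. g \<in> carrier G \<Longrightarrow> h \<in> carrier G \<Longrightarrow> \<chi> (g \<otimes> h) = \<chi> g + \<chi> h"
    and s: "s \<in> carrier G" "\<chi> s \<noteq> 0"
  shows "freely_independent G (\<lambda>g. g) {s}"
  unfolding freely_independent_def
proof (intro conjI ballI impI)
  fix w assume w: "w \<in> words {s}" "eval_word G (\<lambda>g. g) w = \<one>"
  have "\<chi> \<one> = 0" using \<chi>[of \<one> \<one>] by simp
  then have "exp_sum s w = 0"
    using additive_eval_word[OF \<chi> _ _ w(1), of s] w(2) s by auto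
  then show "(w, []) \<in> word_cong {s} {}" using word_cong_single_letter[OF w(1)] by simp
qed (use s in auto)

text \<open>
  The values of \<open>\<chi>\<close> force the exponent sum of \<open>s\<close> in a trivial word to vanish. Such a word is, after
  conjugation by a power of \<open>s\<close>, a word in the elements \<open>s\<^sup>i y s\<^sup>-\<^sup>i\<close> with \<open>i \<ge> 0\<close>, among which there are
  no relations.
\<close>

theorem freely_independent_pair:
  fixes \<chi> :: "'a \<Rightarrow> int"
  assumes \<chi>: "\<And>g h. g \<in> carrier G \<Longrightarrow> h \<in> carrier G \<Longrightarrow> \<chi> (g \<otimes> h) = \<chi> g + \<chi> h"
    and s: "s \<in> carrier G" "\<chi> s \<noteq> 0" and y: "y \<in> carrier G" "\<chi> y = 0"
    and indep: "freely_independent G (\<lambda>i::nat. s [^] i \<otimes> y \<otimes> inv (s [^] i)) UNIV"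
  shows "freely_independent G (\<lambda>g. g) {s, y}"
  unfolding freely_independent_def
proof (intro conjI ballI impI)
  show id: "(\<lambda>g. g) \<in> {s, y} \<rightarrow> carrier G" using s y by auto
  fix w assume w: "w \<in> words {s, y}" "eval_word G (\<lambda>g. g) w = \<one>"
  have "s \<noteq> y" using s y by auto
  have "\<chi> \<one> = 0" using \<chi>[of \<one> \<one>] by simp
  then have "exp_sum s w = 0"
    using additive_eval_word[OF \<chi> _ _ w(1), of s] w(2) s y by auto
  define n where "n = length w"
  define S where "S = replicate n (s, True)"
  define p where "p = conjugate_letters s n w"
  have S: "S \<in> words {s, y}" by (simp add: S_def)
  have cw: "conjugate_word s y i \<in> words {s, y}" for i by (simp add: conjugate_word_def)
  have p: "p \<in> words UNIV" by (simp add: words_def)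
  then have q: "subst_word (conjugate_word s y) p \<in> words {s, y}"
    using cw by (auto intro: subst_word_in_words)
  have 1: "(S @ w, subst_word (conjugate_word s y) p @ S) \<in> word_cong {s, y} {}"
    using word_cong_conjugate_letters[OF w(1) \<open>s \<noteq> y\<close>, of n] \<open>exp_sum s w = 0\<close>
    by (simp add: n_def S_def p_def)
  have ev_rep: "eval_word G (\<lambda>g. g) (replicate i (s, True)) = s [^] i" for i
  proof (induction i)
    case (Suc i)
    then show ?case using s nat_pow_mult[of s 1 i] by simp
  qed simp
  have ev_cw: "eval_word G (\<lambda>g. g) (conjugate_word s y i) = s [^] i \<otimes> y \<otimes> inv (s [^] i)" for i
  proof -
    have "conjugate_word s y i = replicate i (s, True) @ [(y, True)] @ inv_word (replicate i (s, True))"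
      by (simp add: conjugate_word_def)
    then show ?thesis
      using s y by (simp add: eval_word_append[OF _ _ id] eval_word_inv[OF _ id] ev_rep m_assoc
          del: inv_word_replicate)
  qed
  have "eval_word G (\<lambda>g. g) S = eval_word G (\<lambda>g. g) (subst_word (conjugate_word s y) p) \<otimes> eval_word G (\<lambda>g. g) S"
    using eval_word_cong[OF 1 id] w S q eval_word_closed[OF S id] by (simp add: eval_word_append[OF _ _ id])
  then have "eval_word G (\<lambda>g. g) (subst_word (conjugate_word s y) p) = \<one>"
    using eval_word_closed[OF S id] eval_word_closed[OF q id]
    by (simp add: r_cancel_one')
  then have "eval_word G (\<lambda>i. s [^] i \<otimes> y \<otimes> inv (s [^] i)) p = \<one>"
    using eval_word_subst[OF p cw id] by (simp add: ev_cw)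
  then have "(p, []) \<in> word_cong UNIV {}" using indep p by (simp add: freely_independent_def)
  from word_cong_subst[OF this, of "conjugate_word s y" "{s, y}" "{}"]
  have "(subst_word (conjugate_word s y) p, []) \<in> word_cong {s, y} {}" using cw by simp
  from word_cong.append[OF this word_cong.refl[OF S]]
  have "(S @ w, S) \<in> word_cong {s, y} {}" using 1 by (auto intro: word_cong.trans)
  from word_cong.append[OF word_cong.refl[OF inv_word_in_words[OF S]] this]
  have "((inv_word S @ S) @ w, inv_word S @ S) \<in> word_cong {s, y} {}" by simp
  moreover have "((inv_word S @ S) @ w, [] @ w) \<in> word_cong {s, y} {}"
    using S w by (intro word_cong.append word_cong.refl word_cong_inv_left)
  ultimately show "(w, []) \<in> word_cong {s, y} {}"
    using word_cong_inv_left[OF S, of "{}"] by (auto intro: word_cong.trans word_cong.sym)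
qed

lemma freely_independent_hom:
  assumes "group K" "h \<in> hom G K" "inj_on h (carrier G)" "freely_independent G f A"
  shows "freely_independent K (\<lambda>x. h (f x)) A"
proof -
  interpret h: group_hom G K h
    using assms by (simp add: group_hom_def group_hom_axioms_def is_group)
  have f: "f \<in> A \<rightarrow> carrier G" using assms by (simp add: freely_independent_def)
  have "eval_word G f w = \<one>" if "w \<in> words A" "eval_word K (\<lambda>x. h (f x)) w = \<one>\<^bsub>K\<^esub>" for w
  proof (rule inj_onD[OF assms(3)])
    show "h (eval_word G f w) = h \<one>"
      using eval_word_hom[OF assms(1,2) that(1) f] that(2) by simp
  qed (use that f in auto)
  then show ?thesis using assms(4) f by (auto simp: freely_independent_def Pi_iff)
qed

lemma generate_eqI:
  assumes "S \<subseteq> carrier G" "T \<subseteq> carrier G" "S \<subseteq> generate G T" "T \<subseteq> generate G S"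
  shows "generate G S = generate G T"
  using assms by (intro equalityI generate_subgroup_incl generate_is_subgroup) auto

lemma generate_pair_inv: "a \<in> carrier G \<Longrightarrow> b \<in> carrier G \<Longrightarrow> generate G {a, b} = generate G {inv a, b}"
  using generate.inv[of a "{a, b}" G] generate.inv[of "inv a" "{inv a, b}" G]
  by (intro generate_eqI) (auto intro: generate.incl)

lemma generate_pair_mult:
  assumes "a \<in> carrier G" "b \<in> carrier G"
  shows "generate G {a, b} = generate G {a \<otimes> inv b, b}"
proof (rule generate_eqI)
  have "a \<otimes> inv b \<otimes> b \<in> generate G {a \<otimes> inv b, b}"
    by (intro generate.eng generate.incl) auto
  then show "{a, b} \<subseteq> generate G {a \<otimes> inv b, b}"
    using assms by (auto simp: m_assoc intro: generate.incl)
  have "a \<otimes> inv b \<in> generate G {a, b}"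
    by (intro generate.eng generate.incl generate.inv) auto
  then show "{a \<otimes> inv b, b} \<subseteq> generate G {a, b}" by (auto intro: generate.incl)
qed (use assms in auto)

text \<open>
  The subtractive Euclidean algorithm for the values of \<open>\<chi>\<close>, each subtraction being a Nielsen move on
  the pair of generators.
\<close>

lemma generate_pair_euclid:
  fixes \<chi> :: "'a \<Rightarrow> int"
  assumes \<chi>: "\<And>g h. g \<in> carrier G \<Longrightarrow> h \<in> carrier G \<Longrightarrow> \<chi> (g \<otimes> h) = \<chi> g + \<chi> h"
    and "a \<in> carrier G" "b \<in> carrier G"
  shows "\<exists>s\<in>carrier G. \<exists>y\<in>carrier G. \<chi> s \<ge> 0 \<and> \<chi> y = 0 \<and> generate G {a, b} = generate G {s, y}"
proof -
  have "\<chi> \<one> = 0" using \<chi>[of \<one> \<one>] by simp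
  then have inv: "\<chi> (inv g) = - \<chi> g" if "g \<in> carrier G" for g
    using \<chi>[of g "inv g"] that by simp
  have nonneg: "\<exists>s\<in>carrier G. \<exists>y\<in>carrier G. \<chi> s \<ge> 0 \<and> \<chi> y = 0 \<and> generate G {a, b} = generate G {s, y}"
    if "a \<in> carrier G" "b \<in> carrier G" "\<chi> a \<ge> 0" "\<chi> b \<ge> 0" for a b
    using that
  proof (induction "nat (\<chi> a + \<chi> b)" arbitrary: a b rule: less_induct)
    case less
    consider "\<chi> b = 0" | "\<chi> a = 0" | "\<chi> b > 0" "\<chi> a \<ge> \<chi> b" | "\<chi> a > 0" "\<chi> b \<ge> \<chi> a"
      using less.prems by linarith
    then show ?case
    proof cases
      case 1
      then show ?thesis using less.prems by blast
    next
      case 2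
      then show ?thesis using less.prems by (metis insert_commute)
    next
      case 3
      then show ?thesis
        using less.hyps[of "a \<otimes> inv b" b] less.prems generate_pair_mult[of a b] by (simp add: \<chi> inv)
    next
      case 4
      then show ?thesis
        using less.hyps[of "b \<otimes> inv a" a] less.prems generate_pair_mult[of b a]
        by (simp add: \<chi> inv insert_commute)
    qed
  qed
  define a' where "a' = (if \<chi> a \<ge> 0 then a else inv a)"
  define b' where "b' = (if \<chi> b \<ge> 0 then b else inv b)"
  have "generate G {a, b} = generate G {a', b}"
    using generate_pair_inv[OF assms(2,3)] by (simp add: a'_def)
  also have "\<dots> = generate G {a', b'}"
  proof (cases "\<chi> b \<ge> 0")
    case False
    have "a' \<in> carrier G" using assms by (simp add: a'_def)
    from generate_pair_inv[OF assms(3) this] show ?thesis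
      using False by (simp add: b'_def insert_commute[of a'])
  qed (simp add: b'_def)
  finally show ?thesis
    using nonneg[of a' b'] assms inv by (simp add: a'_def b'_def)
qed

lemma conj_hom: "g \<in> carrier G \<Longrightarrow> (\<lambda>x. g \<otimes> x \<otimes> inv g) \<in> hom G G"
proof (rule homI)
  fix x y assume c: "g \<in> carrier G" "x \<in> carrier G" "y \<in> carrier G"
  then have "(g \<otimes> x \<otimes> inv g) \<otimes> (g \<otimes> y \<otimes> inv g) = g \<otimes> (x \<otimes> (inv g \<otimes> g) \<otimes> y) \<otimes> inv g"
    by (simp only: m_assoc m_closed inv_closed)
  then show "g \<otimes> (x \<otimes> y) \<otimes> inv g = (g \<otimes> x \<otimes> inv g) \<otimes> (g \<otimes> y \<otimes> inv g)"
    using c by simp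
qed auto

lemma conj_conj_inv:
  assumes "g \<in> carrier G" "x \<in> carrier G"
  shows "g \<otimes> (inv g \<otimes> x \<otimes> inv (inv g)) \<otimes> inv g = x" "inv g \<otimes> (g \<otimes> x \<otimes> inv g) \<otimes> inv (inv g) = x"
  using assms by (simp_all add: m_assoc) (simp_all flip: m_assoc)

lemma conj_inj: "g \<in> carrier G \<Longrightarrow> inj_on (\<lambda>x. g \<otimes> x \<otimes> inv g) (carrier G)"
  by (rule inj_on_inverseI[of _ "\<lambda>x. inv g \<otimes> x \<otimes> inv (inv g)"]) (rule conj_conj_inv)

lemma generate_hom_image:
  assumes "group K" "h \<in> hom G K" "S \<subseteq> carrier G"
  shows "generate K (h ` S) = h ` generate G S"
proof -
  interpret h: group_hom G K h
    using assms by (simp add: group_hom_def group_hom_axioms_def is_group)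
  show ?thesis using h.generate_img[OF assms(3)] by simp
qed

end

section \<open>The mapping torus and its elements\<close>

locale torus =
  F: group F
  for F :: "('a, 'm) monoid_scheme" +
  fixes \<phi> :: "'a \<Rightarrow> 'a"
  assumes hom: "\<phi> \<in> hom F F" and inj: "inj_on \<phi> (carrier F)"
begin

abbreviation "gens \<equiv> torus_gens F"
abbreviation "rels \<equiv> torus_rels F \<phi>"
abbreviation G where "G \<equiv> mapping_torus F \<phi>"
abbreviation base ("\<iota>") where "\<iota> \<equiv> torus_base F \<phi>"
abbreviation stable where "stable \<equiv> torus_stable F \<phi>"

sublocale G: group G
  unfolding mapping_torus_def by (rule group_presented_group)

lemma iterate_hom: "\<phi> ^^ n \<in> hom F F"
proof (induction n)
  case (Suc n)
  then show ?case using hom by (auto simp: hom_def Pi_iff)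
qed (auto simp: hom_def)

lemma iterate_closed: "x \<in> carrier F \<Longrightarrow> (\<phi> ^^ n) x \<in> carrier F"
  using iterate_hom[of n] by (auto simp: hom_def)

lemma iterate_mult:
  "x \<in> carrier F \<Longrightarrow> y \<in> carrier F \<Longrightarrow> (\<phi> ^^ n) (x \<otimes>\<^bsub>F\<^esub> y) = (\<phi> ^^ n) x \<otimes>\<^bsub>F\<^esub> (\<phi> ^^ n) y"
  using iterate_hom[of n] by (auto simp: hom_def)

lemma iterate_inj: "inj_on (\<phi> ^^ n) (carrier F)"
proof (induction n)
  case (Suc n)
  have "inj_on \<phi> ((\<phi> ^^ n) ` carrier F)"
    using iterate_closed by (intro inj_on_subset[OF inj]) auto
  from comp_inj_on[OF Suc this] show ?case by (simp add: comp_def)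
qed simp

subsection \<open>The base group embeds\<close>

fun height :: "'a torus_gen word \<Rightarrow> int"
where
  "height [] = 0"
| "height ((Base x, b) # w) = height w"
| "height ((Stable, b) # w) = (if b then 1 else -1) + height w"

text \<open>
  For \<open>n\<close> at least the length of \<open>w\<close>, in the mapping torus \<open>t\<^sup>n w\<close> equals
  \<open>level_value n w\<close> times the power of \<open>t\<close> with exponent \<open>n + height w\<close>. For smaller \<open>n\<close> the truncated
  subtraction makes the value meaningless.
\<close>

fun level_value :: "nat \<Rightarrow> 'a torus_gen word \<Rightarrow> 'a"
where
  "level_value n [] = \<one>\<^bsub>F\<^esub>"
| "level_value n ((Base x, b) # w) =
    (if b then (\<phi> ^^ n) x else inv\<^bsub>F\<^esub> (\<phi> ^^ n) x) \<otimes>\<^bsub>F\<^esub> level_value n w"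
| "level_value n ((Stable, b) # w) = level_value (if b then Suc n else n - 1) w"

lemma gens_iff [simp]: "Base x \<in> gens \<longleftrightarrow> x \<in> carrier F" "Stable \<in> gens"
  by (auto simp: torus_gens_def)

lemma height_append [simp]: "height (u @ v) = height u + height v"
  by (induction u rule: height.induct) auto

lemma height_bound: "\<bar>height w\<bar> \<le> int (length w)"
  by (induction w rule: height.induct) auto

lemma level_value_closed: "w \<in> words gens \<Longrightarrow> level_value n w \<in> carrier F"
  by (induction n w rule: level_value.induct) (auto simp: iterate_closed)

lemma level_value_append:
  "u \<in> words gens \<Longrightarrow> v \<in> words gens \<Longrightarrow> length u \<le> n \<Longrightarrow>
    level_value n (u @ v) = level_value n u \<otimes>\<^bsub>F\<^esub> level_value (nat (int n + height u)) v"
proof (induction n u rule: level_value.induct)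
  case (2 n x b w)
  then show ?case by (auto simp: iterate_closed level_value_closed F.m_assoc)
next
  case (3 n b w)
  then show ?case by (cases n) (auto simp: algebra_simps)
qed (auto simp: level_value_closed)

text \<open>
  Equality can be expected for large \<open>n\<close> only: from level \<open>0\<close> the word \<open>t\<inverse> t\<close> leads to level \<open>1\<close>,
  so what follows it is read one level too high.
\<close>

lemma level_value_cong:
  assumes "(u, v) \<in> word_cong gens rels"
  shows "height u = height v \<and> (\<exists>N. \<forall>n\<ge>N. level_value n u = level_value n v)"
  using assms
proof induction
  case (sym u v)
  then show ?case by metis
next
  case (trans u v w)
  then obtain M N where "\<forall>n\<ge>M. level_value n u = level_value n v" "\<forall>n\<ge>N. level_value n v = level_value n w"
    by auto
  then show ?case using trans by (auto intro!: exI[of _ "max M N"])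
next
  case (append u u' v v')
  obtain M N where MN: "\<forall>n\<ge>M. level_value n u = level_value n u'" "\<forall>n\<ge>N. level_value n v = level_value n v'"
    using append.IH by auto
  have w: "u \<in> words gens" "u' \<in> words gens" "v \<in> words gens" "v' \<in> words gens"
    using word_cong_words[OF append(1)] word_cong_words[OF append(2)] by auto
  have "level_value n (u @ v) = level_value n (u' @ v')" if n: "n \<ge> M + N + length u + length u'" for n
  proof -
    have "nat (int n + height u) \<ge> N" using n height_bound[of u] by linarith
    then show ?thesis using n MN w append.IH by (simp add: level_value_append)
  qed
  then show ?case using append.IH by auto
next
  case (cancel x b)
  have "level_value n [(x, b), (x, \<not> b)] = level_value n []" if "n \<ge> 1" for n
    using cancel that by (cases x) (auto simp: iterate_closed)
  then have "\<exists>N. \<forall>n\<ge>N. level_value n [(x, b), (x, \<not> b)] = level_value n []" by blast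
  moreover have "height [(x, b), (x, \<not> b)] = height []" by (cases x) auto
  ultimately show ?case by blast
next
  case (relation u v)
  then consider
      x y where "u = [(Base x, True), (Base y, True)]" "v = [(Base (x \<otimes>\<^bsub>F\<^esub> y), True)]"
        "x \<in> carrier F" "y \<in> carrier F"
    | x where "u = [(Stable, True), (Base x, True), (Stable, False)]" "v = [(Base (\<phi> x), True)]"
        "x \<in> carrier F"
    unfolding torus_rels_def by blast
  then show ?case
    by cases (auto simp: iterate_mult iterate_closed funpow_swap1)
qed auto

abbreviation cls where "cls w \<equiv> word_cong gens rels `` {w}"

lemma carrier_G: "carrier G = cls ` words gens"
  by (auto simp: mapping_torus_def presented_group_def quotient_def)

lemma cls_mult: "u \<in> words gens \<Longrightarrow> v \<in> words gens \<Longrightarrow> cls u \<otimes>\<^bsub>G\<^esub> cls v = cls (u @ v)"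
  unfolding mapping_torus_def by (rule presented_group_mult_class)

lemma one_G: "\<one>\<^bsub>G\<^esub> = cls []"
  by (simp add: mapping_torus_def presented_group_def)

lemma cls_eqI: "(u, v) \<in> word_cong gens rels \<Longrightarrow> cls u = cls v"
  by (rule equiv_class_eq[OF equiv_word_cong])

lemma base_closed [simp]: "x \<in> carrier F \<Longrightarrow> \<iota> x \<in> carrier G"
  by (auto simp: torus_base_def carrier_G)

lemma stable_closed [simp]: "stable \<in> carrier G"
  by (auto simp: torus_stable_def carrier_G)

lemma base_hom: "\<iota> \<in> hom F G"
proof (rule homI)
  fix x y assume x: "x \<in> carrier F" "y \<in> carrier F"
  then have "([(Base x, True), (Base y, True)], [(Base (x \<otimes>\<^bsub>F\<^esub> y), True)]) \<in> word_cong gens rels"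
    by (intro word_cong.relation) (auto simp: torus_rels_def)
  then show "\<iota> (x \<otimes>\<^bsub>F\<^esub> y) = \<iota> x \<otimes>\<^bsub>G\<^esub> \<iota> y"
    using x by (simp add: torus_base_def cls_mult cls_eqI)
qed simp

lemma base_mult: "x \<in> carrier F \<Longrightarrow> y \<in> carrier F \<Longrightarrow> \<iota> (x \<otimes>\<^bsub>F\<^esub> y) = \<iota> x \<otimes>\<^bsub>G\<^esub> \<iota> y"
  using base_hom by (rule hom_mult)

lemma base_inv: "x \<in> carrier F \<Longrightarrow> \<iota> (inv\<^bsub>F\<^esub> x) = inv\<^bsub>G\<^esub> \<iota> x"
  using base_hom F.is_group G.is_group
  by (simp add: group_hom.hom_inv group_hom_def group_hom_axioms_def)

lemma base_inj: "inj_on \<iota> (carrier F)"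
proof (rule inj_onI)
  fix x y assume x: "x \<in> carrier F" and y: "y \<in> carrier F" and eq: "\<iota> x = \<iota> y"
  have "([(Base x, True)], [(Base y, True)]) \<in> word_cong gens rels"
    using eq_equiv_class[OF eq[unfolded torus_base_def] equiv_word_cong] y by simp
  from level_value_cong[OF this]
  obtain n where "level_value n [(Base x, True)] = level_value n [(Base y, True)]" by blast
  then have "(\<phi> ^^ n) x = (\<phi> ^^ n) y" using x y by (simp add: iterate_closed)
  from inj_onD[OF iterate_inj this x y] show "x = y" .
qed

lemma stable_base:
  assumes "x \<in> carrier F"
  shows "stable \<otimes>\<^bsub>G\<^esub> \<iota> x = \<iota> (\<phi> x) \<otimes>\<^bsub>G\<^esub> stable"
proof -
  have \<phi>x: "\<phi> x \<in> carrier F" using iterate_closed[of x 1] assms by simp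
  have "([(Stable, True), (Base x, True), (Stable, False)], [(Base (\<phi> x), True)]) \<in> word_cong gens rels"
    using assms \<phi>x by (intro word_cong.relation) (auto simp: torus_rels_def)
  from word_cong.append[OF this word_cong.refl[of "[(Stable, True)]"]]
  have 1: "([(Stable, True), (Base x, True), (Stable, False), (Stable, True)],
      [(Base (\<phi> x), True), (Stable, True)]) \<in> word_cong gens rels" by simp
  have "([(Stable, True), (Base x, True)] @ [(Stable, False), (Stable, \<not> False)],
      [(Stable, True), (Base x, True)] @ []) \<in> word_cong gens rels"
    using assms by (intro word_cong.append word_cong.refl word_cong.cancel) auto
  then have "([(Stable, True), (Base x, True)], [(Base (\<phi> x), True), (Stable, True)]) \<in> word_cong gens rels"
    using 1 by (auto intro: word_cong.sym word_cong.trans)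
  then show ?thesis using assms \<phi>x
    by (simp add: torus_base_def torus_stable_def cls_mult cls_eqI)
qed

lemma stable_pow_base:
  assumes "x \<in> carrier F"
  shows "stable [^]\<^bsub>G\<^esub> n \<otimes>\<^bsub>G\<^esub> \<iota> x = \<iota> ((\<phi> ^^ n) x) \<otimes>\<^bsub>G\<^esub> stable [^]\<^bsub>G\<^esub> (n::nat)"
  using assms
proof (induction n arbitrary: x)
  case (Suc n)
  have \<phi>x: "\<phi> x \<in> carrier F" using iterate_closed[of x 1] Suc.prems by simp
  have "stable [^]\<^bsub>G\<^esub> Suc n \<otimes>\<^bsub>G\<^esub> \<iota> x = stable [^]\<^bsub>G\<^esub> n \<otimes>\<^bsub>G\<^esub> \<iota> (\<phi> x) \<otimes>\<^bsub>G\<^esub> stable"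
    using Suc.prems \<phi>x by (simp add: G.m_assoc stable_base)
  also have "\<dots> = \<iota> ((\<phi> ^^ Suc n) x) \<otimes>\<^bsub>G\<^esub> stable [^]\<^bsub>G\<^esub> Suc n"
    using Suc.prems \<phi>x iterate_closed[of "\<phi> x" n] by (simp add: Suc.IH G.m_assoc funpow_swap1)
  finally show ?case .
qed simp

text \<open>
  The exponent of \<open>t\<close>; congruent words have the same height.
\<close>

definition degree :: "'a torus_gen word set \<Rightarrow> int"
  where "degree X = height (SOME w. w \<in> X)"

lemma degree_cls: "w \<in> words gens \<Longrightarrow> degree (cls w) = height w"
proof -
  assume w: "w \<in> words gens"
  then have "w \<in> cls w" by (auto intro: word_cong.refl)
  then have "(SOME v. v \<in> cls w) \<in> cls w" by (rule someI)
  then show "degree (cls w) = height w" using level_value_cong by (force simp: degree_def)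
qed

lemma degree_mult: "g \<in> carrier G \<Longrightarrow> h \<in> carrier G \<Longrightarrow> degree (g \<otimes>\<^bsub>G\<^esub> h) = degree g + degree h"
  by (auto simp: carrier_G cls_mult degree_cls)

lemma degree_base [simp]: "x \<in> carrier F \<Longrightarrow> degree (\<iota> x) = 0"
  by (simp add: torus_base_def degree_cls)

lemma degree_stable_pow [simp]: "degree (stable [^]\<^bsub>G\<^esub> (n::nat)) = int n"
proof (induction n)
  case (Suc n)
  then show ?case by (simp add: degree_mult) (simp add: torus_stable_def degree_cls)
qed (simp add: one_G degree_cls)

text \<open>
  Every element has the form \<open>t\<close> to the power \<open>- k\<close>, times an element of \<open>F\<close>, times \<open>t\<^sup>l\<close>. Stated
  without inverses, the property passes to a word with one more letter in front: a positive \<open>t\<close> is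
  absorbed after applying \<open>\<phi>\<close> once, an inverse \<open>t\<close> by increasing \<open>k\<close>.
\<close>

lemma torus_normal_form:
  assumes "g \<in> carrier G"
  shows "\<exists>(k::nat) (l::nat). \<exists>x\<in>carrier F. stable [^]\<^bsub>G\<^esub> k \<otimes>\<^bsub>G\<^esub> g = \<iota> x \<otimes>\<^bsub>G\<^esub> stable [^]\<^bsub>G\<^esub> l"
proof -
  have step: "stable [^]\<^bsub>G\<^esub> Suc k \<otimes>\<^bsub>G\<^esub> g = \<iota> (\<phi> x) \<otimes>\<^bsub>G\<^esub> stable [^]\<^bsub>G\<^esub> Suc l"
    if "stable [^]\<^bsub>G\<^esub> k \<otimes>\<^bsub>G\<^esub> g = \<iota> x \<otimes>\<^bsub>G\<^esub> stable [^]\<^bsub>G\<^esub> l" "g \<in> carrier G" "x \<in> carrier F" for k l :: nat and g x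
  proof -
    have \<phi>x: "\<phi> x \<in> carrier F" using iterate_closed[of x 1] that by simp
    have pow: "stable [^]\<^bsub>G\<^esub> Suc n = stable \<otimes>\<^bsub>G\<^esub> stable [^]\<^bsub>G\<^esub> n" for n
      by (rule G.nat_pow_Suc2) simp
    have "stable [^]\<^bsub>G\<^esub> Suc k \<otimes>\<^bsub>G\<^esub> g = stable \<otimes>\<^bsub>G\<^esub> (stable [^]\<^bsub>G\<^esub> k \<otimes>\<^bsub>G\<^esub> g)"
      unfolding pow using that by (simp add: G.m_assoc)
    also have "\<dots> = \<iota> (\<phi> x) \<otimes>\<^bsub>G\<^esub> (stable \<otimes>\<^bsub>G\<^esub> stable [^]\<^bsub>G\<^esub> l)"
      unfolding that(1) using that \<phi>x by (simp add: stable_base G.m_assoc[symmetric])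
    also have "stable \<otimes>\<^bsub>G\<^esub> stable [^]\<^bsub>G\<^esub> l = stable [^]\<^bsub>G\<^esub> Suc l"
      by (rule pow[symmetric])
    finally show ?thesis .
  qed
  obtain w where w: "w \<in> words gens" "g = cls w" using assms by (auto simp: carrier_G)
  have "\<exists>(k::nat) (l::nat). \<exists>x\<in>carrier F. stable [^]\<^bsub>G\<^esub> k \<otimes>\<^bsub>G\<^esub> cls w = \<iota> x \<otimes>\<^bsub>G\<^esub> stable [^]\<^bsub>G\<^esub> l"
    using w(1)
  proof (induction w rule: words_induct)
    case Nil
    show ?case
      by (intro exI[of _ "0::nat"] exI[of _ "0::nat"] bexI[of _ "\<one>\<^bsub>F\<^esub>"])
        (auto simp: hom_one[OF base_hom F.is_group G.is_group] simp flip: one_G)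
  next
    case (Cons y b w)
    obtain k l :: nat and x where x: "x \<in> carrier F"
      and eq: "stable [^]\<^bsub>G\<^esub> k \<otimes>\<^bsub>G\<^esub> cls w = \<iota> x \<otimes>\<^bsub>G\<^esub> stable [^]\<^bsub>G\<^esub> l" using Cons.IH by auto
    have w: "cls w \<in> carrier G" using Cons.hyps by (auto simp: carrier_G)
    have y: "cls [(y, b)] \<in> carrier G" "cls [(y, True)] \<in> carrier G"
      using Cons.hyps by (auto simp: carrier_G)
    have split: "cls ((y, b) # w) = cls [(y, b)] \<otimes>\<^bsub>G\<^esub> cls w" using Cons.hyps by (simp add: cls_mult)
    have yb: "cls [(y, b)] = (if b then cls [(y, True)] else inv\<^bsub>G\<^esub> cls [(y, True)])"
    proof (cases b)
      case False
      have "cls [(y, False)] \<otimes>\<^bsub>G\<^esub> cls [(y, True)] = \<one>\<^bsub>G\<^esub>"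
        using Cons.hyps word_cong.cancel[of y gens False rels] by (simp add: cls_mult one_G cls_eqI)
      then show ?thesis using False y by (simp add: G.inv_equality)
    qed simp
    show ?case
    proof (cases y)
      case (Base z)
      then have z: "z \<in> carrier F" using Cons.hyps by simp
      define z' where "z' = (if b then z else inv\<^bsub>F\<^esub> z)"
      have z': "z' \<in> carrier F" using z by (simp add: z'_def)
      have "\<iota> (inv\<^bsub>F\<^esub> z) = inv\<^bsub>G\<^esub> \<iota> z"
        using z base_hom F.is_group G.is_group
        by (simp add: group_hom.hom_inv group_hom_def group_hom_axioms_def)
      then have "cls [(y, b)] = \<iota> z'" using yb Base by (simp add: z'_def torus_base_def)
      then have "stable [^]\<^bsub>G\<^esub> k \<otimes>\<^bsub>G\<^esub> cls ((y, b) # w) =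
          stable [^]\<^bsub>G\<^esub> k \<otimes>\<^bsub>G\<^esub> \<iota> z' \<otimes>\<^bsub>G\<^esub> cls w"
        using w z' by (simp add: split G.m_assoc)
      also have "\<dots> = \<iota> ((\<phi> ^^ k) z') \<otimes>\<^bsub>G\<^esub> (stable [^]\<^bsub>G\<^esub> k \<otimes>\<^bsub>G\<^esub> cls w)"
        using w z' by (simp add: stable_pow_base G.m_assoc iterate_closed)
      also have "\<dots> = \<iota> ((\<phi> ^^ k) z' \<otimes>\<^bsub>F\<^esub> x) \<otimes>\<^bsub>G\<^esub> stable [^]\<^bsub>G\<^esub> l"
        using x z' by (simp add: eq base_mult iterate_closed G.m_assoc)
      finally show ?thesis using x z' iterate_closed by blast
    next
      case Stable
      then have st: "cls [(y, True)] = stable" by (simp add: torus_stable_def)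
      have \<phi>x: "\<phi> x \<in> carrier F" using iterate_closed[of x 1] x by simp
      show ?thesis
      proof (cases b)
        case True
        then have "stable [^]\<^bsub>G\<^esub> k \<otimes>\<^bsub>G\<^esub> cls ((y, b) # w) = stable [^]\<^bsub>G\<^esub> Suc k \<otimes>\<^bsub>G\<^esub> cls w"
          unfolding split yb using w by (simp add: st G.m_assoc)
        then show ?thesis using step[OF eq w x] \<phi>x by metis
      next
        case False
        have "stable \<otimes>\<^bsub>G\<^esub> (inv\<^bsub>G\<^esub> stable \<otimes>\<^bsub>G\<^esub> cls w) = cls w"
          using w by (simp flip: G.m_assoc)
        then have "stable [^]\<^bsub>G\<^esub> Suc k \<otimes>\<^bsub>G\<^esub> cls ((y, b) # w) = stable [^]\<^bsub>G\<^esub> k \<otimes>\<^bsub>G\<^esub> cls w"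
          unfolding split yb using w False by (simp add: st G.m_assoc)
        then show ?thesis using eq x by metis
      qed
    qed
  qed
  then show ?thesis using w by simp
qed

text \<open>
  Conjugating \<open>x t\<^sup>m\<close> by \<open>t\<close> yields \<open>\<phi>(x) t\<^sup>m\<close>, so all sufficiently large exponents work; this allows
  one exponent for two elements.
\<close>

lemma conj_into_base_times_pow:
  assumes g: "g \<in> carrier G" "degree g = int m"
  shows "\<exists>k::nat. \<forall>n\<ge>k. \<exists>x\<in>carrier F.
    stable [^]\<^bsub>G\<^esub> n \<otimes>\<^bsub>G\<^esub> g \<otimes>\<^bsub>G\<^esub> inv\<^bsub>G\<^esub> (stable [^]\<^bsub>G\<^esub> n) = \<iota> x \<otimes>\<^bsub>G\<^esub> stable [^]\<^bsub>G\<^esub> (m::nat)"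
proof -
  obtain k l :: nat and x where x: "x \<in> carrier F"
    and eq: "stable [^]\<^bsub>G\<^esub> k \<otimes>\<^bsub>G\<^esub> g = \<iota> x \<otimes>\<^bsub>G\<^esub> stable [^]\<^bsub>G\<^esub> l" using torus_normal_form[OF g(1)] by auto
  have "degree (stable [^]\<^bsub>G\<^esub> k \<otimes>\<^bsub>G\<^esub> g) = degree (\<iota> x \<otimes>\<^bsub>G\<^esub> stable [^]\<^bsub>G\<^esub> l)" by (simp only: eq)
  then have l: "l = m + k" using g x by (simp add: degree_mult)
  have "\<exists>x\<in>carrier F. stable [^]\<^bsub>G\<^esub> n \<otimes>\<^bsub>G\<^esub> g \<otimes>\<^bsub>G\<^esub> inv\<^bsub>G\<^esub> (stable [^]\<^bsub>G\<^esub> n) = \<iota> x \<otimes>\<^bsub>G\<^esub> stable [^]\<^bsub>G\<^esub> m"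
    if "n \<ge> k" for n :: nat
  proof (intro bexI)
    define d where "d = n - k"
    define y where "y = (\<phi> ^^ d) x"
    have y: "y \<in> carrier F" using x by (simp add: y_def iterate_closed)
    have n: "stable [^]\<^bsub>G\<^esub> n = stable [^]\<^bsub>G\<^esub> d \<otimes>\<^bsub>G\<^esub> stable [^]\<^bsub>G\<^esub> k"
      using that G.nat_pow_mult[of stable d k] by (simp add: d_def)
    have "stable [^]\<^bsub>G\<^esub> n \<otimes>\<^bsub>G\<^esub> g = stable [^]\<^bsub>G\<^esub> d \<otimes>\<^bsub>G\<^esub> \<iota> x \<otimes>\<^bsub>G\<^esub> stable [^]\<^bsub>G\<^esub> l"
      using g x by (simp add: n G.m_assoc eq)
    also have "\<dots> = \<iota> y \<otimes>\<^bsub>G\<^esub> (stable [^]\<^bsub>G\<^esub> d \<otimes>\<^bsub>G\<^esub> stable [^]\<^bsub>G\<^esub> l)"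
      using x y by (simp add: stable_pow_base G.m_assoc y_def)
    also have "stable [^]\<^bsub>G\<^esub> d \<otimes>\<^bsub>G\<^esub> stable [^]\<^bsub>G\<^esub> l = stable [^]\<^bsub>G\<^esub> m \<otimes>\<^bsub>G\<^esub> stable [^]\<^bsub>G\<^esub> n"
      using that G.nat_pow_mult[of stable d l] G.nat_pow_mult[of stable m n] by (simp add: l d_def add.commute)
    finally show "stable [^]\<^bsub>G\<^esub> n \<otimes>\<^bsub>G\<^esub> g \<otimes>\<^bsub>G\<^esub> inv\<^bsub>G\<^esub> (stable [^]\<^bsub>G\<^esub> n) = \<iota> y \<otimes>\<^bsub>G\<^esub> stable [^]\<^bsub>G\<^esub> m"
      using g(1) y by (simp only: G.m_assoc base_closed G.nat_pow_closed stable_closed G.inv_closed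
          G.r_inv G.r_one G.m_closed)
    show "y \<in> carrier F" by (rule y)
  qed
  then show ?thesis by blast
qed

end

section \<open>Two-generator subgroups\<close>

context torus
begin

text \<open>
  The endomorphism of \<open>F\<close> induced by conjugation with \<open>u t\<^sup>m\<close>.
\<close>

definition twist :: "'a \<Rightarrow> nat \<Rightarrow> 'a \<Rightarrow> 'a"
  where "twist u m x = u \<otimes>\<^bsub>F\<^esub> (\<phi> ^^ m) x \<otimes>\<^bsub>F\<^esub> inv\<^bsub>F\<^esub> u"

lemma twist_hom: "u \<in> carrier F \<Longrightarrow> twist u m \<in> hom F F"
  using hom_compose[OF iterate_hom F.conj_hom, of u m]
  by (simp add: twist_def[abs_def] comp_def)

lemma twist_closed: "u \<in> carrier F \<Longrightarrow> x \<in> carrier F \<Longrightarrow> twist u m x \<in> carrier F"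
  using twist_hom[of u m] by (auto simp: hom_def)

lemma conj_twist:
  fixes m :: nat
  assumes "u \<in> carrier F" "x \<in> carrier F"
  defines "s \<equiv> \<iota> u \<otimes>\<^bsub>G\<^esub> stable [^]\<^bsub>G\<^esub> m"
  shows "s \<otimes>\<^bsub>G\<^esub> \<iota> x \<otimes>\<^bsub>G\<^esub> inv\<^bsub>G\<^esub> s = \<iota> (twist u m x)"
proof -
  define T where "T = stable [^]\<^bsub>G\<^esub> m"
  have T: "T \<in> carrier G" by (simp add: T_def)
  have c: "\<iota> u \<in> carrier G" "\<iota> x \<in> carrier G" "\<iota> ((\<phi> ^^ m) x) \<in> carrier G" "(\<phi> ^^ m) x \<in> carrier F"
    using assms by (auto simp: iterate_closed)
  have "s \<otimes>\<^bsub>G\<^esub> \<iota> x \<otimes>\<^bsub>G\<^esub> inv\<^bsub>G\<^esub> s = \<iota> u \<otimes>\<^bsub>G\<^esub> (T \<otimes>\<^bsub>G\<^esub> \<iota> x) \<otimes>\<^bsub>G\<^esub> inv\<^bsub>G\<^esub> T \<otimes>\<^bsub>G\<^esub> inv\<^bsub>G\<^esub> \<iota> u"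
    using c T by (simp add: s_def T_def[symmetric] G.inv_mult_group G.m_assoc)
  also have "T \<otimes>\<^bsub>G\<^esub> \<iota> x = \<iota> ((\<phi> ^^ m) x) \<otimes>\<^bsub>G\<^esub> T"
    unfolding T_def by (rule stable_pow_base[OF assms(2)])
  also have "\<iota> u \<otimes>\<^bsub>G\<^esub> (\<iota> ((\<phi> ^^ m) x) \<otimes>\<^bsub>G\<^esub> T) \<otimes>\<^bsub>G\<^esub> inv\<^bsub>G\<^esub> T \<otimes>\<^bsub>G\<^esub> inv\<^bsub>G\<^esub> \<iota> u = \<iota> (twist u m x)"
    using c T assms by (simp add: twist_def base_mult base_inv G.m_assoc)
  finally show ?thesis .
qed

lemma conj_pow_twist:
  fixes m i :: nat
  assumes "u \<in> carrier F" "x \<in> carrier F"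
  defines "s \<equiv> \<iota> u \<otimes>\<^bsub>G\<^esub> stable [^]\<^bsub>G\<^esub> m"
  shows "s [^]\<^bsub>G\<^esub> i \<otimes>\<^bsub>G\<^esub> \<iota> x \<otimes>\<^bsub>G\<^esub> inv\<^bsub>G\<^esub> (s [^]\<^bsub>G\<^esub> i) = \<iota> ((twist u m ^^ i) x)"
proof (induction i)
  case (Suc i)
  have s: "s \<in> carrier G" using assms by (simp add: s_def)
  define S where "S = s [^]\<^bsub>G\<^esub> i"
  have S: "S \<in> carrier G" using s by (simp add: S_def)
  have y: "(twist u m ^^ i) x \<in> carrier F" using assms by (induction i) (auto simp: twist_closed)
  have Suc_pow: "s [^]\<^bsub>G\<^esub> Suc i = s \<otimes>\<^bsub>G\<^esub> S" unfolding S_def by (rule G.nat_pow_Suc2[OF s])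
  have "s [^]\<^bsub>G\<^esub> Suc i \<otimes>\<^bsub>G\<^esub> \<iota> x \<otimes>\<^bsub>G\<^esub> inv\<^bsub>G\<^esub> (s [^]\<^bsub>G\<^esub> Suc i) =
      s \<otimes>\<^bsub>G\<^esub> (S \<otimes>\<^bsub>G\<^esub> \<iota> x \<otimes>\<^bsub>G\<^esub> inv\<^bsub>G\<^esub> S) \<otimes>\<^bsub>G\<^esub> inv\<^bsub>G\<^esub> s"
    unfolding Suc_pow using s S assms(2) by (simp add: G.inv_mult_group G.m_assoc)
  also have "S \<otimes>\<^bsub>G\<^esub> \<iota> x \<otimes>\<^bsub>G\<^esub> inv\<^bsub>G\<^esub> S = \<iota> ((twist u m ^^ i) x)" using Suc.IH by (simp add: S_def)
  also have "s \<otimes>\<^bsub>G\<^esub> \<iota> ((twist u m ^^ i) x) \<otimes>\<^bsub>G\<^esub> inv\<^bsub>G\<^esub> s = \<iota> ((twist u m ^^ Suc i) x)"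
    using conj_twist[OF assms(1) y] by (simp add: s_def)
  finally show ?case .
qed (use assms in simp)

text \<open>
  The orbit of \<open>v\<close> under conjugation by \<open>s\<close> stays in \<open>F\<close>, and the dichotomy for orbits decides between
  the two alternatives. A trivial \<open>v\<close> is set apart because a sub-mapping torus needs a nontrivial base
  group.
\<close>

lemma standard_pair_free_or_sub_torus:
  fixes m :: nat
  assumes free: "is_free_group F" and u: "u \<in> carrier F" and v: "v \<in> carrier F" and m: "m \<ge> 1"
  defines "s \<equiv> \<iota> u \<otimes>\<^bsub>G\<^esub> stable [^]\<^bsub>G\<^esub> m"
  shows "(\<exists>S. freely_independent G (\<lambda>g. g) S \<and> generate G S = generate G {s, \<iota> v}) \<or>
    sub_mapping_torus F \<phi> (generate G {s, \<iota> v})"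
proof -
  have s: "s \<in> carrier G" "degree s = int m" using u by (auto simp: s_def degree_mult)
  have \<iota>v: "\<iota> v \<in> carrier G" using v by simp
  obtain f and A :: "'a set" where fA: "freely_independent F f A" "generate F (f ` A) = carrier F"
    using is_free_group_obtains_basis[OF free] by blast
  define orb where "orb i = (twist u m ^^ i) v" for i
  have orb_closed: "orb i \<in> carrier F" for i
    unfolding orb_def using u v by (induction i) (auto simp: twist_closed)
  consider "v = \<one>\<^bsub>F\<^esub>" | "freely_independent F orb UNIV"
    | B where "v \<noteq> \<one>\<^bsub>F\<^esub>" "finite B" "B \<subseteq> carrier F" "generate F B = generate F (range orb)"
    using F.orbit_free_or_finitely_generated[OF fA twist_hom[OF u] v, of m] unfolding orb_def by blast
  then show ?thesis
  proof cases
    case 1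
    then have "\<iota> v = \<one>\<^bsub>G\<^esub>" using hom_one[OF base_hom F.is_group G.is_group] by simp
    then have "generate G {s} = generate G {s, \<iota> v}"
      using s by (intro G.generate_eqI) (auto intro: generate.incl generate.one)
    moreover have "freely_independent G (\<lambda>g. g) {s}"
      using s m by (intro G.freely_independent_single[of degree]) (auto simp: degree_mult)
    ultimately show ?thesis by blast
  next
    case 2
    have "freely_independent G (\<lambda>i. \<iota> (orb i)) UNIV"
      by (rule F.freely_independent_hom[OF G.is_group base_hom base_inj 2])
    then have "freely_independent G (\<lambda>i::nat. s [^]\<^bsub>G\<^esub> i \<otimes>\<^bsub>G\<^esub> \<iota> v \<otimes>\<^bsub>G\<^esub> inv\<^bsub>G\<^esub> (s [^]\<^bsub>G\<^esub> i)) UNIV"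
      unfolding s_def conj_pow_twist[OF u v] by (simp add: orb_def)
    then have "freely_independent G (\<lambda>g. g) {s, \<iota> v}"
      using s v m by (intro G.freely_independent_pair[of degree]) (auto simp: degree_mult)
    then show ?thesis by blast
  next
    case (3 B)
    define V where "V = generate F (range orb)"
    have V_sub: "V \<subseteq> carrier F" unfolding V_def using orb_closed by (intro F.generate_incl) auto
    have orb_V: "orb i \<in> V" for i unfolding V_def by (intro generate.incl) auto
    have v_V: "v \<in> V" using orb_V[of 0] by (simp add: orb_def)
    let ?H = "generate G {s, \<iota> v}"
    have H: "subgroup ?H G" using s \<iota>v by (intro G.generate_is_subgroup) auto
    have s_H: "s \<in> ?H" "\<iota> v \<in> ?H" by (auto intro: generate.incl)
    have "\<iota> (orb i) \<in> ?H" for i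
    proof (induction i)
      case 0
      show ?case using s_H by (simp add: orb_def)
    next
      case (Suc i)
      have "s \<otimes>\<^bsub>G\<^esub> \<iota> (orb i) \<otimes>\<^bsub>G\<^esub> inv\<^bsub>G\<^esub> s \<in> ?H"
        using Suc s_H H by (intro subgroup.m_closed[OF H] subgroup.m_inv_closed[OF H])
      then show ?case using conj_twist[OF u orb_closed] by (simp add: s_def orb_def)
    qed
    then have "generate G (\<iota> ` range orb) \<subseteq> ?H"
      using H by (intro G.generate_subgroup_incl) auto
    moreover have "generate G (\<iota> ` range orb) = \<iota> ` V"
      unfolding V_def using orb_closed by (intro F.generate_hom_image[OF G.is_group base_hom]) auto
    ultimately have \<iota>V: "\<iota> ` V \<subseteq> ?H" by simp
    have "generate G (insert s (\<iota> ` V)) = ?H"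
      using s \<iota>v V_sub \<iota>V s_H v_V by (intro G.generate_eqI) (auto intro: generate.incl)
    moreover have "twist u m x \<in> V" if "x \<in> V" for x
    proof -
      have "generate F (twist u m ` range orb) = twist u m ` V"
        unfolding V_def using orb_closed
        by (intro F.generate_hom_image[OF F.is_group twist_hom[OF u]]) auto
      moreover have "twist u m ` range orb \<subseteq> range orb"
      proof -
        have "twist u m (orb i) = orb (Suc i)" for i by (simp add: orb_def)
        then show ?thesis by blast
      qed
      ultimately have "twist u m ` V \<subseteq> V" using F.mono_generate[of "twist u m ` range orb" "range orb"]
        by (simp add: V_def)
      then show ?thesis using that by blast
    qed
    then have "(\<lambda>x. s \<otimes>\<^bsub>G\<^esub> x \<otimes>\<^bsub>G\<^esub> inv\<^bsub>G\<^esub> s) ` (\<iota> ` V) \<subseteq> \<iota> ` V"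
      using conj_twist[OF u] V_sub by (auto simp: s_def)
    moreover have "fg_subgroup V F" using 3 by (auto simp: fg_subgroup_def V_def)
    moreover have "V \<noteq> {\<one>\<^bsub>F\<^esub>}" using v_V 3 by auto
    moreover have "fg_subgroup ?H G"
      unfolding fg_subgroup_def using s \<iota>v by (intro exI[of _ "{s, \<iota> v}"]) auto
    ultimately have "sub_mapping_torus F \<phi> ?H"
      unfolding sub_mapping_torus_def Let_def s_def using u m by metis
    then show ?thesis ..
  qed
qed

text \<open>
  Both alternatives are invariant under conjugation, so the generators may be moved into the position
  required by \<open>standard_pair_free_or_sub_torus\<close>.
\<close>

lemma two_generator_free_or_sub_torus:
  assumes free: "is_free_group F" and a: "a \<in> carrier G" and b: "b \<in> carrier G"
  shows "is_free_group (G\<lparr>carrier := generate G {a, b}\<rparr>) \<or>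
    (\<exists>K. sub_mapping_torus F \<phi> K \<and> conjugate_in G (generate G {a, b}) K)"
proof -
  obtain s y where s: "s \<in> carrier G" "degree s \<ge> 0" and y: "y \<in> carrier G" "degree y = 0"
    and H: "generate G {a, b} = generate G {s, y}"
    using G.generate_pair_euclid[OF degree_mult a b] by blast
  define m where "m = nat (degree s)"
  have "degree s = int m" using s by (simp add: m_def)
  from conj_into_base_times_pow[OF s(1) this] obtain k :: nat where k: "\<And>n. n \<ge> k \<Longrightarrow> \<exists>x\<in>carrier F.
      stable [^]\<^bsub>G\<^esub> n \<otimes>\<^bsub>G\<^esub> s \<otimes>\<^bsub>G\<^esub> inv\<^bsub>G\<^esub> (stable [^]\<^bsub>G\<^esub> n) = \<iota> x \<otimes>\<^bsub>G\<^esub> stable [^]\<^bsub>G\<^esub> m"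
    by blast
  have "degree y = int 0" using y by simp
  from conj_into_base_times_pow[OF y(1) this] obtain l :: nat where l: "\<And>n. n \<ge> l \<Longrightarrow> \<exists>x\<in>carrier F.
      stable [^]\<^bsub>G\<^esub> n \<otimes>\<^bsub>G\<^esub> y \<otimes>\<^bsub>G\<^esub> inv\<^bsub>G\<^esub> (stable [^]\<^bsub>G\<^esub> n) = \<iota> x \<otimes>\<^bsub>G\<^esub> stable [^]\<^bsub>G\<^esub> (0::nat)"
    by blast
  define t where "t = stable [^]\<^bsub>G\<^esub> max k l"
  have t: "t \<in> carrier G" "inv\<^bsub>G\<^esub> t \<in> carrier G" by (simp_all add: t_def)
  obtain u where u: "u \<in> carrier F" "t \<otimes>\<^bsub>G\<^esub> s \<otimes>\<^bsub>G\<^esub> inv\<^bsub>G\<^esub> t = \<iota> u \<otimes>\<^bsub>G\<^esub> stable [^]\<^bsub>G\<^esub> m"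
    using k[of "max k l"] by (auto simp: t_def)
  obtain v where v: "v \<in> carrier F" "t \<otimes>\<^bsub>G\<^esub> y \<otimes>\<^bsub>G\<^esub> inv\<^bsub>G\<^esub> t = \<iota> v"
    using l[of "max k l"] by (auto simp: t_def)
  define r where "r = \<iota> u \<otimes>\<^bsub>G\<^esub> stable [^]\<^bsub>G\<^esub> m"
  define c where "c = (\<lambda>x. inv\<^bsub>G\<^esub> t \<otimes>\<^bsub>G\<^esub> x \<otimes>\<^bsub>G\<^esub> inv\<^bsub>G\<^esub> (inv\<^bsub>G\<^esub> t))"
  have c_hom: "c \<in> hom G G" unfolding c_def by (rule G.conj_hom[OF t(2)])
  have c_inj: "inj_on c (carrier G)" unfolding c_def by (rule G.conj_inj[OF t(2)])
  have "c r = s" "c (\<iota> v) = y"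
    using G.conj_conj_inv(2)[OF t(1) s(1)] G.conj_conj_inv(2)[OF t(1) y(1)]
    by (simp_all add: c_def r_def flip: u(2) v(2))
  then have "{s, y} = c ` {r, \<iota> v}" by simp
  then have H': "generate G {a, b} = c ` generate G {r, \<iota> v}"
    unfolding H using u v by (simp only:) (intro G.generate_hom_image[OF G.is_group c_hom]; simp add: r_def)
  have free_if: "is_free_group (G\<lparr>carrier := generate G {a, b}\<rparr>)"
    if S: "freely_independent G (\<lambda>g. g) S" "generate G S = generate G {r, \<iota> v}" for S
  proof -
    have "S \<subseteq> carrier G" using S by (auto simp: freely_independent_def)
    then have "generate G (c ` S) = generate G {a, b}"
      using G.generate_hom_image[OF G.is_group c_hom] S by (simp add: H')
    moreover have "freely_independent G c S"
      using G.freely_independent_hom[OF G.is_group c_hom c_inj S(1)] by simp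
    ultimately show ?thesis using G.freely_independent_imp_free by metis
  qed
  show ?thesis
  proof (cases "m = 0")
    case True
    obtain f and A :: "'a set" where fA: "freely_independent F f A" "generate F (f ` A) = carrier F"
      using is_free_group_obtains_basis[OF free] by blast
    have "subgroup (generate F {u, v}) F" using u v by (intro F.generate_is_subgroup) auto
    then obtain B where B: "freely_independent F (\<lambda>g. g) B" "generate F B = generate F {u, v}"
      using F.nielsen_schreier[OF fA] by blast
    have "freely_independent G \<iota> B"
      using F.freely_independent_hom[OF G.is_group base_hom base_inj B(1)] by simp
    then have 1: "freely_independent G (\<lambda>g. g) (\<iota> ` B)" by (rule G.freely_independent_image)
    have "B \<subseteq> carrier F" using B by (auto simp: freely_independent_def)
    then have "generate G (\<iota> ` B) = generate G (\<iota> ` {u, v})"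
      using F.generate_hom_image[OF G.is_group base_hom] B(2) u v by (simp del: image_insert)
    then have "generate G (\<iota> ` B) = generate G {r, \<iota> v}" using True u by (simp add: r_def)
    with free_if[OF 1] show ?thesis by blast
  next
    case False
    then have "m \<ge> 1" by simp
    from standard_pair_free_or_sub_torus[OF free u(1) v(1) this]
    consider S where "freely_independent G (\<lambda>g. g) S" "generate G S = generate G {r, \<iota> v}"
      | "sub_mapping_torus F \<phi> (generate G {r, \<iota> v})"
      unfolding r_def by blast
    then show ?thesis
    proof cases
      case (1 S)
      then show ?thesis using free_if by blast
    next
      case 2
      have "conjugate_in G (generate G {a, b}) (generate G {r, \<iota> v})"
        unfolding conjugate_in_def H' c_def using t by blast
      with 2 show ?thesis by blast
    qed
  qed
qed

end

theorem theorem1: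
  fixes F :: "('a, 'm) monoid_scheme"
    and \<phi> :: "'a \<Rightarrow> 'a"
    and H :: "'a torus_gen word set set"
  assumes "is_free_group F"
    and "\<phi> \<in> hom F F"
    and "inj_on \<phi> (carrier F)"
    and "two_generator_subgroup H (mapping_torus F \<phi>)"
  shows "is_free_group ((mapping_torus F \<phi>)\<lparr>carrier := H\<rparr>) \<or>
    (\<exists>K. sub_mapping_torus F \<phi> K \<and> conjugate_in (mapping_torus F \<phi>) H K)"
proof -
  interpret torus F \<phi>
    using assms by (intro torus.intro torus_axioms.intro) (simp_all add: is_free_group_def)
  obtain a b where "a \<in> carrier G" "b \<in> carrier G" "H = generate G {a, b}"
    using assms(4) by (auto simp: two_generator_subgroup_def)
  then show ?thesis using two_generator_free_or_sub_torus[OF assms(1)] by simp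
qed

end
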